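(* The set $\mathcal{M}(\mathbb{H})$ is a group under composition.
   Context: $\mathbb{H}$ is the hyperbolic plane (upper half-plane model), with ideal boundary $\hat{\mathbb{R}}=\mathbb{R}\cup\{\infty\}$; $\hat{\mathbb{Q}}=\mathbb{Q}\cup\{\infty\}$. Farey triangulation: $\mathcal{F}$ is the orbit, under the group generated by hyperbolic reflections in the sides of the ideal triangle with vertices $0,1,\infty$, of that triangle; $\mathcal{F}$ also denotes the set of its edges (complete geodesics). Its vertex set is $\hat{\mathbb{Q}}$, and $\frac ab,\frac cd$ (in lowest terms, $\infty=\frac10$) are joined by an edge iff $|ad-bc|=1$. For a homeomorphism $h$ of $\hat{\mathbb{R}}$, $h(\mathcal{F})$ is the ideal triangulation whose edges are the geodesics with endpoints the $h$-images of the endpoints of $E$, for $E\in\mathcal{F}$. An allowable triangulation of $\mathbb{H}$ is a locally finite ideal triangulation (every compact region of $\mathbb{H}$ meets finitely many edges) whose set of vertices is $\hat{\mathbb{Q}}$; a triangulation is identified with its set of edges. For a geodesic $\alpha$ with endpoints in $\hat{\mathbb{Q}}$ and an allowable triangulation $\mathcal{T}$, $i(\alpha,\mathcal{T})$ is the number of transverse intersection points in $\mathbb{H}$ of $\alpha$ with the edges of $\mathcal{T}$. Two allowable triangulations $\mathcal{T}_1,\mathcal{T}_2$ have the finite intersection property if $\sup_{\alpha_1\in\mathcal{T}_1} i(\alpha_1,\mathcal{T}_2)<\infty$ and $\sup_{\alpha_2\in\mathcal{T}_2} i(\alpha_2,\mathcal{T}_1)<\infty$. $\mathcal{M}(\mathbb{H})$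 is the set of all homeomorphisms $h:\hat{\mathbb{R}}\to\hat{\mathbb{R}}$ preserving $\hat{\mathbb{Q}}$ (i.e. $h(\hat{\mathbb{Q}})=\hat{\mathbb{Q}}$) such that $\mathcal{F}$ and $h(\mathcal{F})$ have the finite intersection property. *)

theory Defs
  imports "HOL-Analysis.Analysis" "HOL-Algebra.Bij" "HOL-Algebra.Generated_Groups"
    "HOL-Library.Extended_Nat"
begin

section \<open>The upper half-plane and its ideal boundary\<close>

definition upper_half_plane :: "complex set" where
  "upper_half_plane = {z. Im z > 0}"

text \<open>An ideal point is \<^term>\<open>Some a\<close> for a real \<^term>\<open>a\<close>, or \<^term>\<open>None\<close> for infinity.\<close>

type_synonym ideal_point = "real option"

definition Rhat :: "ideal_point topology" where
  "Rhat = Alexandroff_compactification euclideanreal"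

definition Qhat :: "ideal_point set" where
  "Qhat = insert None (Some ` \<rat>)"

text \<open>The complete geodesic with the given two ideal endpoints; meaningful (and used) only for
  distinct endpoints.\<close>

fun geodesic :: "ideal_point \<Rightarrow> ideal_point \<Rightarrow> complex set" where
  "geodesic (Some a) (Some b) =
     upper_half_plane \<inter> sphere (of_real ((a + b) / 2)) (\<bar>a - b\<bar> / 2)"
| "geodesic (Some a) None = {z \<in> upper_half_plane. Re z = a}"
| "geodesic None (Some a) = {z \<in> upper_half_plane. Re z = a}"
| "geodesic None None = {}"

text \<open>Reflection in the geodesic with the given endpoints: inversion in the semicircle, or
  Euclidean reflection in the vertical line.\<close>

fun reflection :: "ideal_point \<Rightarrow> ideal_point \<Rightarrow> complex \<Rightarrow> complex" where
  "reflection (Some a) (Some b) z =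
     of_real ((a + b) / 2) + of_real (((a - b) / 2)\<^sup>2) / cnj (z - of_real ((a + b) / 2))"
| "reflection (Some a) None z = of_real (2 * a) - cnj z"
| "reflection None (Some a) z = of_real (2 * a) - cnj z"
| "reflection None None z = z"

text \<open>\<open>half_plane x y w\<close> is the closed half-plane of the hyperbolic plane that is bounded by the
  geodesic from \<open>x\<close> to \<open>y\<close> and has the ideal point \<open>w\<close> in its ideal boundary; the three ideal
  points are meant to be distinct.\<close>

fun half_plane :: "ideal_point \<Rightarrow> ideal_point \<Rightarrow> ideal_point \<Rightarrow> complex set" where
  "half_plane (Some a) (Some b) None =
     upper_half_plane - ball (of_real ((a + b) / 2)) (\<bar>a - b\<bar> / 2)"
| "half_plane (Some a) (Some b) (Some c) =
     (if min a b < c \<and> c < max a b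
      then upper_half_plane \<inter> cball (of_real ((a + b) / 2)) (\<bar>a - b\<bar> / 2)
      else upper_half_plane - ball (of_real ((a + b) / 2)) (\<bar>a - b\<bar> / 2))"
| "half_plane (Some a) None (Some c) =
     {z \<in> upper_half_plane. if c < a then Re z \<le> a else a \<le> Re z}"
| "half_plane None (Some a) (Some c) =
     {z \<in> upper_half_plane. if c < a then Re z \<le> a else a \<le> Re z}"
| "half_plane _ _ _ = {}"

text \<open>The closed ideal triangle with vertex set \<open>V\<close>, where \<open>V\<close> has three elements.\<close>

definition ideal_triangle :: "ideal_point set \<Rightarrow> complex set" where
  "ideal_triangle V = \<Inter> {half_plane x y w | x y w. {x, y, w} = V}"

definition sides :: "ideal_point set \<Rightarrow> complex set set" where
  "sides V = {geodesic x y | x y. x \<in> V \<and> y \<in> V \<and> x \<noteq> y}"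

section \<open>Allowable triangulations\<close>

text \<open>A triangulation is represented by its set of edges.\<close>

definition ideal_triangulation :: "complex set set \<Rightarrow> bool" where
  "ideal_triangulation T \<longleftrightarrow>
     (\<exists>\<V>. (\<forall>V\<in>\<V>. card V = 3) \<and>
          (\<Union>V\<in>\<V>. ideal_triangle V) = upper_half_plane \<and>
          pairwise (\<lambda>V W. interior (ideal_triangle V) \<inter> interior (ideal_triangle W) = {}) \<V> \<and>
          T = (\<Union>V\<in>\<V>. sides V))"

definition locally_finite_edges :: "complex set set \<Rightarrow> bool" where
  "locally_finite_edges T \<longleftrightarrow>
     (\<forall>K. compact K \<and> K \<subseteq> upper_half_plane \<longrightarrow> finite {E \<in> T. E \<inter> K \<noteq> {}})"

definition vertices :: "complex set set \<Rightarrow> ideal_point set" where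
  "vertices T = {x. \<exists>y. x \<noteq> y \<and> geodesic x y \<in> T}"

definition allowable :: "complex set set \<Rightarrow> bool" where
  "allowable T \<longleftrightarrow> ideal_triangulation T \<and> locally_finite_edges T \<and> vertices T = Qhat"

text \<open>Two distinct complete geodesics meet in at most one point, and then transversely, so the
  transverse intersection points of a geodesic with the edges of a triangulation are its
  intersection points with the edges different from it.\<close>

definition intersection_number :: "complex set \<Rightarrow> complex set set \<Rightarrow> enat" where
  "intersection_number \<alpha> T =
     (let P = {z \<in> \<alpha>. \<exists>E\<in>T. E \<noteq> \<alpha> \<and> z \<in> E}
      in if finite P then enat (card P) else \<infinity>)"

definition finite_intersection_property :: "complex set set \<Rightarrow> complex set set \<Rightarrow> bool" where
  "finite_intersection_property T1 T2 \<longleftrightarrow>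
     allowable T1 \<and> allowable T2 \<and>
     (SUP \<alpha>\<in>T1. intersection_number \<alpha> T2) < \<infinity> \<and>
     (SUP \<alpha>\<in>T2. intersection_number \<alpha> T1) < \<infinity>"

section \<open>The Farey triangulation\<close>

definition basic_vertices :: "ideal_point set" where
  "basic_vertices = {Some 0, Some 1, None}"

definition farey_group :: "(complex \<Rightarrow> complex) set" where
  "farey_group = generate (BijGroup upper_half_plane)
     {restrict (reflection x y) upper_half_plane | x y.
        x \<in> basic_vertices \<and> y \<in> basic_vertices \<and> x \<noteq> y}"

definition farey :: "complex set set" where
  "farey = {g ` E | g E. g \<in> farey_group \<and> E \<in> sides basic_vertices}"

definition image_triangulation :: "(ideal_point \<Rightarrow> ideal_point) \<Rightarrow> complex set set \<Rightarrow> complex set set" where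
  "image_triangulation h T = {geodesic (h x) (h y) | x y. x \<noteq> y \<and> geodesic x y \<in> T}"

section \<open>The set of homeomorphisms\<close>

definition MH :: "(ideal_point \<Rightarrow> ideal_point) set" where
  "MH = {h. homeomorphic_map Rhat Rhat h \<and> h ` Qhat = Qhat \<and>
            finite_intersection_property farey (image_triangulation h farey)}"

end

theory Submission
  imports Defs
begin

text \<open>Every homeomorphism of the circle at infinity either keeps or reverses the cyclic order, so it maps
interleaved pairs of points to interleaved pairs. Since two geodesics cross exactly when their pairs
of endpoints interleave, a homeomorphism \<open>h\<close> respects crossings of geodesics, although it does
not act on the half-plane. The theorem then reduces to two facts. First, \<open>h\<close> carries the
Farey triangulation to an allowable triangulation as soon as it preserves the rational points
(\<open>MH_iff\<close>), so membership of \<open>h\<close> in \<open>MH\<close> is only a question about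
bounds for numbers of crossings. Second, bounded crossing is transitive (\<open>crossings_bounded_trans\<close>).
With these, an inverse is obtained by applying \<open>h\<inverse>\<close> to both triangulations, and a product
\<open>h \<circ> g\<close> by comparing the Farey triangulation \<open>F\<close> first with \<open>h(F)\<close> and then
\<open>h(F)\<close> with \<open>h(g(F))\<close>; the second pair is the \<open>h\<close>-image of the pair \<open>F\<close>,
\<open>g(F)\<close>.

Transitivity: let an edge \<open>e\<close> of the first triangulation cross at most \<open>n\<close> edges of the
second, and let the edges of the second cross at most \<open>m\<close> edges of the third. If \<open>e\<close> is itself
an edge of the second there is nothing to do. Otherwise every triangle of the second triangulation that
meets \<open>e\<close> has a side crossing \<open>e\<close>; as an edge lies on at most two triangles, at most \<open>2 n\<close>
triangles occur. An edge of the third triangulation that crosses \<open>e\<close> does so inside one of these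
triangles, hence is a side of it or crosses a side of it, which leaves a number of possibilities bounded
in terms of \<open>n\<close> and \<open>m\<close>.

For allowability, the properties of the Farey triangulation that matter are isolated in the locale
\<open>combinatorial_triangulation\<close>. They mention only ideal points, interleaving and the topology
of the circle, so they pass to homeomorphic images (\<open>combinatorial_triangulation_image\<close>), and
they imply that the geodesic triangles form a locally finite ideal triangulation. Local finiteness comes
from compactness of the torus of pairs of ideal points. Covering (\<open>covers\<close>) follows from it: only
finitely many edges separate a given point \<open>z\<close> from a point inside some fixed triangle, and the
triangle lying behind the separating edge nearest to \<open>z\<close> must contain \<open>z\<close>.

All the hyperbolic geometry is linear algebra, as in Klein's model: \<open>z\<close> is represented by the vector
\<open>(\<bar>z\<bar>\<^sup>2, Re z, 1)\<close> and the ideal point with homogeneous coordinates \<open>(x, x')\<close>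
by \<open>(x\<^sup>2, x x', x'\<^sup>2)\<close>. Geodesics become planes and half-planes become half-spaces,
and points of a geodesic or of a triangle become nonnegative combinations of its ideal vertices.\<close>

section \<open>Linear coordinates for ideal points\<close>

text \<open>The vector \<open>(hnum x, hden x)\<close> consists of homogeneous coordinates of \<open>x\<close>, so that
\<open>\<infinity> = 1 / 0\<close> needs no special treatment in polynomial identities.\<close>

fun hnum :: "ideal_point \<Rightarrow> real" where
  "hnum (Some a) = a"
| "hnum None = 1"

fun hden :: "ideal_point \<Rightarrow> real" where
  "hden (Some a) = 1"
| "hden None = 0"

definition bracket :: "ideal_point \<Rightarrow> ideal_point \<Rightarrow> real" where
  "bracket x y = hnum x * hden y - hnum y * hden x"

text \<open>The sign of \<open>side x y w\<close> tells in which of the two arcs between \<open>x\<close> and \<open>y\<close> the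
point \<open>w\<close> lies.\<close>

definition side :: "ideal_point \<Rightarrow> ideal_point \<Rightarrow> ideal_point \<Rightarrow> real" where
  "side x y w = bracket x w * bracket y w"

text \<open>This is the linear form in \<open>(\<bar>z\<bar>\<^sup>2, Re z, 1)\<close> whose kernel is the plane of the geodesic
from \<open>x\<close> to \<open>y\<close>. On the vector of an ideal point \<open>w\<close> the same form takes the value
\<open>side x y w\<close>, so the two signs can be compared.\<close>

definition level :: "ideal_point \<Rightarrow> ideal_point \<Rightarrow> complex \<Rightarrow> real" where
  "level x y z = ((Re z)\<^sup>2 + (Im z)\<^sup>2) * (hden x * hden y)
     - Re z * (hnum x * hden y + hden x * hnum y) + hnum x * hnum y"

text \<open>The pairs interleave on the circle; equivalently the cross-ratio of the four points is negative.\<close>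

definition linked :: "ideal_point \<Rightarrow> ideal_point \<Rightarrow> ideal_point \<Rightarrow> ideal_point \<Rightarrow> bool" where
  "linked x y z w \<longleftrightarrow> side x y z * side x y w < 0"

lemma bracket_eq_0_iff [simp]: "bracket x y = 0 \<longleftrightarrow> x = y"
  by (cases x; cases y) (auto simp: bracket_def)

lemma bracket_swap: "bracket y x = - bracket x y"
  by (simp add: bracket_def)

lemma side_eq_0_iff [simp]: "side x y w = 0 \<longleftrightarrow> w = x \<or> w = y"
  by (auto simp: side_def)

lemma side_ends [simp]: "side x y x = 0" "side x y y = 0"
  by simp_all

lemma side_commute: "side x y w = side y x w"
  by (simp add: side_def)

lemma level_commute: "level x y z = level y x z"
  by (simp add: level_def algebra_simps)

lemma linked_commute: "linked x y z w \<longleftrightarrow> linked z w x y"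
  unfolding linked_def side_def
  using bracket_swap[of x z] bracket_swap[of x w] bracket_swap[of y z] bracket_swap[of y w]
  by (simp add: mult_ac)

lemma linked_swap1: "linked x y z w \<longleftrightarrow> linked y x z w"
  by (simp add: linked_def side_commute)

lemma linked_distinct:
  assumes "linked x y z w"
  shows "z \<noteq> x" "z \<noteq> y" "w \<noteq> x" "w \<noteq> y" "z \<noteq> w" "x \<noteq> y"
proof -
  have n: "side x y z * side x y w < 0"
    using assms by (simp add: linked_def)
  have "side x y z \<noteq> 0" "side x y w \<noteq> 0"
    using n by auto
  then show "z \<noteq> x" "z \<noteq> y" "w \<noteq> x" "w \<noteq> y"
    by auto
  show "z \<noteq> w"
    using n by (metis not_square_less_zero)
  have "side z w x * side z w y < 0"
    using assms linked_commute linked_def by blast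
  then show "x \<noteq> y"
    by (metis not_square_less_zero)
qed

text \<open>The product of the three quantities whose signs are at stake is minus a nonzero square, so one
of them is negative: \<open>w\<close> lies in one of the three arcs left by \<open>u\<close>, \<open>v\<close>, \<open>t\<close>.\<close>

lemma three_sides_of_triangle:
  assumes "u \<noteq> v" "u \<noteq> t" "v \<noteq> t" "w \<noteq> u" "w \<noteq> v" "w \<noteq> t"
  shows "linked u v t w \<or> linked v t u w \<or> linked u t v w"
proof (rule ccontr)
  assume a: "\<not> ?thesis"
  let ?A = "side u v t * side u v w" and ?B = "side v t u * side v t w"
    and ?C = "side u t v * side u t w"
  have "?A \<ge> 0" "?B \<ge> 0" "?C \<ge> 0"
    using a by (auto simp: linked_def not_less)
  then have "?A * ?B * ?C \<ge> 0"
    by (simp only: mult_nonneg_nonneg)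
  moreover have "?A * ?B * ?C
      = - ((bracket u v * bracket u t * bracket v t * bracket u w * bracket v w * bracket t w)\<^sup>2)"
    unfolding side_def using bracket_swap[of u v] bracket_swap[of u t] bracket_swap[of v t]
    by (simp add: power2_eq_square algebra_simps)
  ultimately show False
    using assms by (simp add: zero_le_power2)
qed

section \<open>Geodesics and half-planes\<close>

lemma sphere_iff:
  assumes "r > 0"
  shows "z \<in> sphere (complex_of_real c) r \<longleftrightarrow> (Re z - c)\<^sup>2 + (Im z)\<^sup>2 = r\<^sup>2"
proof -
  have "dist (complex_of_real c) z = sqrt ((Re z - c)\<^sup>2 + (Im z)\<^sup>2)"
    by (simp add: dist_norm cmod_def power2_commute)
  then show ?thesis
    using assms by (auto simp: real_sqrt_eq_iff real_sqrt_unique)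
qed

lemma ball_iff:
  assumes "r > 0"
  shows "z \<in> ball (complex_of_real c) r \<longleftrightarrow> (Re z - c)\<^sup>2 + (Im z)\<^sup>2 < r\<^sup>2"
    and "z \<in> cball (complex_of_real c) r \<longleftrightarrow> (Re z - c)\<^sup>2 + (Im z)\<^sup>2 \<le> r\<^sup>2"
proof -
  have d: "dist (complex_of_real c) z = sqrt ((Re z - c)\<^sup>2 + (Im z)\<^sup>2)"
    by (simp add: dist_norm cmod_def power2_commute)
  have r: "r = sqrt (r\<^sup>2)"
    using assms by simp
  show "z \<in> ball (complex_of_real c) r \<longleftrightarrow> (Re z - c)\<^sup>2 + (Im z)\<^sup>2 < r\<^sup>2"
    unfolding mem_ball d by (subst r) (rule real_sqrt_less_iff)
  show "z \<in> cball (complex_of_real c) r \<longleftrightarrow> (Re z - c)\<^sup>2 + (Im z)\<^sup>2 \<le> r\<^sup>2"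
    unfolding mem_cball d by (subst r) (rule real_sqrt_le_iff)
qed

lemma level_Some_Some:
  "level (Some a) (Some b) z = (Re z - (a + b) / 2)\<^sup>2 + (Im z)\<^sup>2 - (\<bar>a - b\<bar> / 2)\<^sup>2"
  by (simp add: level_def power2_eq_square field_simps)

lemma geodesic_iff:
  assumes "x \<noteq> y"
  shows "z \<in> geodesic x y \<longleftrightarrow> Im z > 0 \<and> level x y z = 0"
proof (cases x; cases y)
  fix a b assume xy: "x = Some a" "y = Some b"
  then have "\<bar>a - b\<bar> / 2 > 0"
    using assms by simp
  from sphere_iff[OF this, of z "(a + b) / 2"] show ?thesis
    unfolding xy geodesic.simps level_Some_Some by (auto simp: upper_half_plane_def)
qed (use assms in \<open>auto simp: level_def upper_half_plane_def\<close>)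

lemma half_plane_iff:
  assumes "x \<noteq> y" "w \<noteq> x" "w \<noteq> y"
  shows "z \<in> half_plane x y w \<longleftrightarrow> Im z > 0 \<and> level x y z * side x y w \<ge> 0"
proof (cases x; cases y)
  fix a b assume xy: "x = Some a" "y = Some b"
  then have "\<bar>a - b\<bar> / 2 > 0"
    using assms by simp
  note b = ball_iff[OF this, of z "(a + b) / 2"]
  show ?thesis
  proof (cases w)
    case None
    then show ?thesis
      unfolding xy None half_plane.simps level_Some_Some using b
      by (auto simp: upper_half_plane_def side_def bracket_def)
  next
    case (Some c)
    have s: "side x y w = (a - c) * (b - c)"
      by (simp add: side_def bracket_def xy Some)
    show ?thesis
    proof (cases "min a b < c \<and> c < max a b")
      case True
      then have "side x y w < 0"
        unfolding s by (auto simp: mult_less_0_iff min_def max_def split: if_splits)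
      then have "level x y z * side x y w \<ge> 0 \<longleftrightarrow> level x y z \<le> 0"
        by (auto simp: zero_le_mult_iff)
      then show ?thesis
        using True b unfolding xy Some half_plane.simps level_Some_Some
        by (auto simp: upper_half_plane_def)
    next
      case False
      then have "side x y w > 0"
        using assms xy Some unfolding s
        by (auto simp: zero_less_mult_iff min_def max_def split: if_splits)
      then have "level x y z * side x y w \<ge> 0 \<longleftrightarrow> level x y z \<ge> 0"
        by (auto simp: zero_le_mult_iff)
      then show ?thesis
        using False b unfolding xy Some half_plane.simps level_Some_Some
        by (auto simp: upper_half_plane_def)
    qed
  qed
next
  fix a assume xy: "x = Some a" "y = None"
  then obtain c where c: "w = Some c"
    using assms by (cases w) auto
  then show ?thesis
    using assms unfolding xy
    by (auto simp: upper_half_plane_def level_def side_def bracket_def zero_le_mult_iff)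
next
  fix a assume xy: "x = None" "y = Some a"
  then obtain c where c: "w = Some c"
    using assms by (cases w) auto
  then show ?thesis
    using assms unfolding xy
    by (auto simp: upper_half_plane_def level_def side_def bracket_def zero_le_mult_iff)
qed (use assms in auto)

lemma geodesic_commute: "x \<noteq> y \<Longrightarrow> geodesic x y = geodesic y x"
  by (auto simp: geodesic_iff level_commute)

lemma triple_eq_cases:
  assumes "u \<noteq> v" "u \<noteq> t" "v \<noteq> t" and e: "{x, y, w} = {u, v, t}"
  shows "(x, y, w) \<in> {(u, v, t), (u, t, v), (v, t, u), (v, u, t), (t, u, v), (t, v, u)}"
proof -
  have "card {x, y, w} = 3"
    using assms unfolding e by simp
  then have d: "x \<noteq> y" "x \<noteq> w" "y \<noteq> w"
    by (auto simp: card_insert_if split: if_splits)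
  have "x = u \<or> x = v \<or> x = t" "y = u \<or> y = v \<or> y = t" "w = u \<or> w = v \<or> w = t"
    using e by blast+
  then show ?thesis
    using d by (elim disjE) simp_all
qed

lemma ideal_triangle_iff:
  assumes "u \<noteq> v" "u \<noteq> t" "v \<noteq> t"
  shows "z \<in> ideal_triangle {u, v, t} \<longleftrightarrow>
    Im z > 0 \<and> level u v z * side u v t \<ge> 0 \<and> level u t z * side u t v \<ge> 0
      \<and> level v t z * side v t u \<ge> 0"
proof -
  have "z \<in> ideal_triangle {u, v, t} \<longleftrightarrow> (\<forall>x y w. {x, y, w} = {u, v, t} \<longrightarrow> z \<in> half_plane x y w)"
    unfolding ideal_triangle_def by blast
  also have "\<dots> \<longleftrightarrow> z \<in> half_plane u v t \<and> z \<in> half_plane u t v \<and> z \<in> half_plane v t u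
      \<and> z \<in> half_plane v u t \<and> z \<in> half_plane t u v \<and> z \<in> half_plane t v u"
    (is "?L \<longleftrightarrow> ?R")
  proof
    assume ?L
    then show ?R
      by (intro conjI) (drule spec, drule spec, drule spec, erule mp, blast)+
  next
    assume ?R
    show ?L
    proof (intro allI impI)
      fix x y w assume e: "{x, y, w} = {u, v, t}"
      show "z \<in> half_plane x y w"
        using triple_eq_cases[OF assms e] \<open>?R\<close> by (elim insertE) simp_all
    qed
  qed
  also have "\<dots> \<longleftrightarrow> Im z > 0 \<and> level u v z * side u v t \<ge> 0 \<and> level u t z * side u t v \<ge> 0
      \<and> level v t z * side v t u \<ge> 0"
    using assms
    unfolding half_plane_iff[OF assms(1) assms(2)[symmetric] assms(3)[symmetric]]
      half_plane_iff[OF assms(2) assms(1)[symmetric] assms(3)]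
      half_plane_iff[OF assms(3) assms(1) assms(2)]
      half_plane_iff[OF assms(1)[symmetric] assms(3)[symmetric] assms(2)[symmetric]]
      half_plane_iff[OF assms(2)[symmetric] assms(3) assms(1)[symmetric]]
      half_plane_iff[OF assms(3)[symmetric] assms(2) assms(1)]
      level_commute[of v u] level_commute[of t u] level_commute[of t v]
      side_commute[of v u] side_commute[of t u] side_commute[of t v]
    by blast
  finally show ?thesis .
qed

section \<open>Intersections of geodesics and ideal triangles\<close>

text \<open>For real \<open>x\<close> the value is the squared Euclidean distance of \<open>z\<close> from \<open>x\<close>; for
\<open>x = \<infinity>\<close> it is \<open>1\<close>.\<close>

lemma level_self_pos:
  assumes "Im z > 0"
  shows "level x x z > 0"
proof (cases x)
  case (Some a)
  have "level x x z = (Re z - a)\<^sup>2 + (Im z)\<^sup>2"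
    by (simp add: Some level_def power2_eq_square algebra_simps)
  then show ?thesis
    using assms by (simp add: add_nonneg_pos)
qed (simp add: level_def)

text \<open>The levels for the pairs \<open>(0, \<infinity>)\<close> and \<open>(0, 0)\<close> are \<open>- Re z\<close> and
\<open>\<bar>z\<bar>\<^sup>2\<close>, which determine a point with positive imaginary part.\<close>

lemma complex_eq_if_levels_eq:
  assumes "Im z > 0" "Im w > 0" "\<And>a b. level a b z = level a b w"
  shows "z = w"
proof -
  have r: "Re z = Re w"
    using assms(3)[of "Some 0" None] by (simp add: level_def)
  moreover have "(Im z)\<^sup>2 = (Im w)\<^sup>2"
    using assms(3)[of "Some 0" "Some 0"] r by (simp add: level_def)
  ultimately show ?thesis
    using assms(1,2) by (simp add: complex_eq_iff power2_eq_iff_nonneg)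
qed

text \<open>The vectors of three distinct ideal points form a basis of three-dimensional space, with dual basis
given by the forms of the three sides; this is the expansion of the vector of \<open>z\<close> with
denominators cleared.\<close>

lemma barycentric:
  "bracket p q * bracket p r * bracket q r * level a b z
     = bracket q r * level q r z * side a b p - bracket p r * level p r z * side a b q
       + bracket p q * level p q z * side a b r"
  unfolding bracket_def level_def side_def by algebra

text \<open>The three quotients are the barycentric coordinates of \<open>z\<close> in the triangle
\<open>p q r\<close>; they are nonnegative exactly when \<open>z\<close> lies in the triangle.\<close>

lemma barycentric_coordinates:
  assumes "p \<noteq> q" "p \<noteq> r" "q \<noteq> r"
  shows "level a b z = level q r z / side q r p * side a b p
    + level p r z / side p r q * side a b q + level p q z / side p q r * side a b r"
proof -
  define X where "X = bracket p q"
  define Y where "Y = bracket p r"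
  define Z where "Z = bracket q r"
  have nz: "X \<noteq> 0" "Y \<noteq> 0" "Z \<noteq> 0"
    using assms by (simp_all add: X_def Y_def Z_def)
  have s: "side q r p = X * Y" "side p r q = - (X * Z)" "side p q r = Y * Z"
    using bracket_swap[of q r] bracket_swap[of p q] bracket_swap[of p r]
    by (simp_all add: side_def X_def Y_def Z_def)
  have "X * Y * Z * level a b z = Z * level q r z * side a b p - Y * level p r z * side a b q
       + X * level p q z * side a b r"
    using barycentric[of p q r a b z] by (simp add: X_def Y_def Z_def)
  then have "level a b z = (Z * level q r z * side a b p - Y * level p r z * side a b q
       + X * level p q z * side a b r) / (X * Y * Z)"
    using nz by (simp add: eq_divide_eq mult.commute)
  also have "\<dots> = level q r z / (X * Y) * side a b p
    + level p r z / (- (X * Z)) * side a b q + level p q z / (Y * Z) * side a b r"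
    using nz by (simp add: add_divide_distrib diff_divide_distrib)
  finally show ?thesis
    unfolding s .
qed

lemma level_on_triangle_nonpos:
  assumes d: "p \<noteq> q" "p \<noteq> r" "q \<noteq> r" and z: "z \<in> ideal_triangle {p, q, r}"
    and k: "side a b p * k \<le> 0" "side a b q * k \<le> 0" "side a b r * k \<le> 0"
  shows "level a b z * k \<le> 0"
proof -
  have div: "l / s \<ge> 0" if "l * s \<ge> 0" for l s :: real
    using that by (auto simp: zero_le_mult_iff zero_le_divide_iff)
  have c: "level q r z / side q r p \<ge> 0" "level p r z / side p r q \<ge> 0" "level p q z / side p q r \<ge> 0"
    using z unfolding ideal_triangle_iff[OF d] by (auto intro!: div)
  have "level a b z * k = level q r z / side q r p * (side a b p * k)
    + level p r z / side p r q * (side a b q * k) + level p q z / side p q r * (side a b r * k)"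
    unfolding barycentric_coordinates[OF d, of a b z] by (simp add: algebra_simps)
  also have "\<dots> \<le> 0"
    using mult_nonneg_nonpos[OF c(1) k(1)] mult_nonneg_nonpos[OF c(2) k(2)]
      mult_nonneg_nonpos[OF c(3) k(3)] by linarith
  finally show ?thesis .
qed

text \<open>The barycentric expansion for the form attached to the pair \<open>(x, x)\<close>, which vanishes at the vertex
\<open>x\<close>. As the left-hand side is positive, a point of the half-plane cannot have two negative
barycentric coordinates. This is what orders the sides of a triangle as seen from a point outside it.\<close>

lemma level_at_vertex:
  assumes "x \<noteq> y" "x \<noteq> w" "y \<noteq> w"
  shows "level x x z = level x w z / side x w y * (bracket x y)\<^sup>2
    + level x y z / side x y w * (bracket x w)\<^sup>2"
  using barycentric_coordinates[OF assms, of x x z] by (simp add: side_def power2_eq_square)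

text \<open>A geodesic is an open chord, so its points are positive combinations of its ends.\<close>

lemma geodesic_point_combination:
  assumes "x \<noteq> y" "z \<in> geodesic x y"
  obtains l m where "l > 0" "m > 0" "\<And>a b. level a b z = l * side a b x + m * side a b y"
proof -
  have z: "Im z > 0" "level x y z = 0"
    using assms by (auto simp: geodesic_iff)
  have v: "(Im z)\<^sup>2 > 0"
    using z by simp
  have "\<exists>l m. l > 0 \<and> m > 0 \<and> (\<forall>a b. level a b z = l * side a b x + m * side a b y)"
  proof (cases x; cases y)
    fix p q assume xy: "x = Some p" "y = Some q"
    have pq: "q - p \<noteq> 0"
      using assms xy by auto
    let ?l = "(q - Re z) / (q - p)" and ?m = "(Re z - p) / (q - p)"
    have s: "(Im z)\<^sup>2 = (p + q) * Re z - p * q - (Re z)\<^sup>2"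
      using z(2) by (simp add: xy level_def algebra_simps)
    have sum: "?l + ?m = 1"
      using pq by (simp add: add_divide_distrib[symmetric])
    have "A / D * (B / D) * D\<^sup>2 = A * B" if "D \<noteq> 0" for A B D :: real
      using that by (simp add: power2_eq_square)
    from this[OF pq] have "?l * ?m * (q - p)\<^sup>2 = (q - Re z) * (Re z - p)" .
    also have "\<dots> = (Im z)\<^sup>2"
      unfolding s by (simp add: power2_eq_square algebra_simps)
    finally have "?l * ?m * (q - p)\<^sup>2 = (Im z)\<^sup>2" .
    then have "?l * ?m > 0"
      using v by (metis zero_less_mult_pos2 zero_less_power2 pq)
    then have "?l > 0 \<and> ?m > 0"
      unfolding zero_less_mult_iff using sum by linarith
    moreover have "level a b z = ?l * side a b x + ?m * side a b y" for a b
    proof -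
      have "(q - p) * level a b z = (q - Re z) * side a b x + (Re z - p) * side a b y"
        unfolding level_def s side_def bracket_def xy hnum.simps hden.simps by algebra
      then have "level a b z = ((q - Re z) * side a b x + (Re z - p) * side a b y) / (q - p)"
        using pq by (metis nonzero_mult_div_cancel_left)
      then show ?thesis
        by (simp add: add_divide_distrib)
    qed
    ultimately show ?thesis
      by blast
  next
    fix p assume xy: "x = Some p" "y = None"
    then have r: "Re z = p"
      using z(2) by (simp add: level_def)
    have "level a b z = 1 * side a b x + (Im z)\<^sup>2 * side a b y" for a b
      unfolding level_def side_def bracket_def xy r hnum.simps hden.simps by algebra
    then show ?thesis
      using v zero_less_one by blast
  next
    fix p assume xy: "x = None" "y = Some p"
    then have r: "Re z = p"
      using z(2) by (simp add: level_def)
    have "level a b z = (Im z)\<^sup>2 * side a b x + 1 * side a b y" for a b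
      unfolding level_def side_def bracket_def xy r hnum.simps hden.simps by algebra
    then show ?thesis
      using v zero_less_one by blast
  qed (use assms in auto)
  then show ?thesis
    using that by blast
qed

text \<open>A vector \<open>(s, t, u)\<close> strictly inside the cone \<open>s u > t\<^sup>2\<close> is a
positive multiple of the vector of a point of the half-plane.\<close>

lemma hyperbolic_point_exists:
  fixes s t u :: real
  assumes "u > 0" "s * u > t\<^sup>2"
  obtains z where "Im z > 0"
    "\<And>a b. u * level a b z
       = s * (hden a * hden b) - t * (hnum a * hden b + hden a * hnum b) + u * (hnum a * hnum b)"
proof
  let ?z = "Complex (t / u) (sqrt (s / u - (t / u)\<^sup>2))"
  have "s / u - (t / u)\<^sup>2 = (s * u - t\<^sup>2) / u\<^sup>2"
    using assms(1) by (simp add: field_simps power2_eq_square)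
  then have pos: "s / u - (t / u)\<^sup>2 > 0"
    using assms by simp
  then show "Im ?z > 0"
    by simp
  have "(Re ?z)\<^sup>2 + (Im ?z)\<^sup>2 = s / u"
    using pos by simp
  then have "level a b ?z = (s / u) * (hden a * hden b)
      - (t / u) * (hnum a * hden b + hden a * hnum b) + hnum a * hnum b" for a b
    unfolding level_def by simp
  then show "u * level a b ?z
       = s * (hden a * hden b) - t * (hnum a * hden b + hden a * hnum b) + u * (hnum a * hnum b)" for a b
    using assms(1) by (simp add: field_simps)
qed

text \<open>The discriminant \<open>s u - t\<^sup>2\<close> of the combination is \<open>l m [x, y]\<^sup>2\<close>, which is positive.\<close>

lemma combination_is_geodesic_point:
  assumes "x \<noteq> y" "l > 0" "m > 0"
  obtains z c where "c > 0" "z \<in> geodesic x y"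
    "\<And>a b. c * level a b z = l * side a b x + m * side a b y"
proof -
  let ?s = "l * (hnum x)\<^sup>2 + m * (hnum y)\<^sup>2"
  let ?t = "l * (hnum x * hden x) + m * (hnum y * hden y)"
  let ?u = "l * (hden x)\<^sup>2 + m * (hden y)\<^sup>2"
  have u: "?u > 0"
    using assms by (cases x; cases y) (auto simp: add_pos_pos)
  have "?s * ?u - ?t\<^sup>2 = l * m * (bracket x y)\<^sup>2"
    unfolding bracket_def by algebra
  moreover have "l * m * (bracket x y)\<^sup>2 > 0"
    using assms by simp
  ultimately have "?s * ?u > ?t\<^sup>2"
    by linarith
  then obtain z where z: "Im z > 0" "\<And>a b. ?u * level a b z
       = ?s * (hden a * hden b) - ?t * (hnum a * hden b + hden a * hnum b) + ?u * (hnum a * hnum b)"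
    by (rule hyperbolic_point_exists[OF u]) (rule that)
  have e: "?u * level a b z = l * side a b x + m * side a b y" for a b
    unfolding z(2) side_def bracket_def by algebra
  have "level x y z = 0"
    using e[of x y] u by simp
  then have "z \<in> geodesic x y"
    using z(1) assms(1) by (simp add: geodesic_iff)
  then show ?thesis
    using that u e by blast
qed

text \<open>The form of the geodesic \<open>x y\<close> takes opposite signs at \<open>z\<close> and \<open>w\<close>, so some positive
combination of them lies in its kernel.\<close>

lemma geodesics_meet_if_linked:
  assumes "linked x y z w"
  shows "geodesic x y \<inter> geodesic z w \<noteq> {}"
proof -
  note d = linked_distinct[OF assms]
  let ?a = "side x y z" and ?b = "side x y w"
  have ab: "?a * ?b < 0"
    using assms by (simp add: linked_def)
  then have pos: "\<bar>?b\<bar> > 0" "\<bar>?a\<bar> > 0"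
    by auto
  obtain p c where p: "c > 0" "p \<in> geodesic z w"
    "\<And>a b. c * level a b p = \<bar>?b\<bar> * side a b z + \<bar>?a\<bar> * side a b w"
    by (rule combination_is_geodesic_point[OF d(5) pos]) (rule that)
  have "c * level x y p = 0"
    unfolding p(3) using ab by (auto simp: mult_less_0_iff)
  then have "level x y p = 0"
    using p(1) by simp
  then have "p \<in> geodesic x y"
    using p(2) d by (simp add: geodesic_iff)
  then show ?thesis
    using p(2) by blast
qed

text \<open>At a common point a positive combination of \<open>side x y z\<close> and \<open>side x y w\<close> vanishes,
so either the two have opposite signs or both are zero.\<close>

lemma geodesics_meet_imp:
  assumes "x \<noteq> y" "z \<noteq> w" "p \<in> geodesic x y" "p \<in> geodesic z w"
  shows "linked x y z w \<or> {x, y} = {z, w}"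
proof -
  obtain l m where lm: "l > 0" "m > 0" "\<And>a b. level a b p = l * side a b z + m * side a b w"
    by (rule geodesic_point_combination[OF assms(2,4)]) (rule that)
  have "level x y p = 0"
    using assms by (simp add: geodesic_iff)
  then have e: "l * side x y z = - (m * side x y w)"
    using lm(3)[of x y] by simp
  show ?thesis
  proof (cases "side x y w = 0")
    case True
    then have "side x y z = 0"
      using e lm(1) by (metis less_irrefl minus_zero mult_eq_0_iff)
    then show ?thesis
      using True assms(1,2) by (auto simp: doubleton_eq_iff)
  next
    case False
    have "l * (side x y z * side x y w) = - (m * (side x y w)\<^sup>2)"
      using e by (simp add: power2_eq_square mult.assoc[symmetric])
    also have "\<dots> < 0"
      using False lm by simp
    finally show ?thesis
      using lm by (simp add: linked_def mult_less_0_iff)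
  qed
qed

text \<open>The vanishing of \<open>level x y\<close> fixes the ratio of the two weights of a common point on the chord
\<open>z w\<close>, and the normalisation of its last coordinate to \<open>1\<close> fixes the weights themselves.\<close>

lemma linked_geodesics_meet_once:
  assumes "linked x y z w" "p \<in> geodesic x y" "p \<in> geodesic z w"
    "q \<in> geodesic x y" "q \<in> geodesic z w"
  shows "p = q"
proof -
  note d = linked_distinct[OF assms(1)]
  let ?a = "side x y z" and ?b = "side x y w"
  obtain l m where lm: "l > 0" "m > 0" "\<And>a b. level a b p = l * side a b z + m * side a b w"
    by (rule geodesic_point_combination[OF d(5) assms(3)]) (rule that)
  obtain l' m' where lm': "l' > 0" "m' > 0" "\<And>a b. level a b q = l' * side a b z + m' * side a b w"
    by (rule geodesic_point_combination[OF d(5) assms(5)]) (rule that)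
  have b: "?b \<noteq> 0"
    using d by simp
  have "level x y p = 0" "level x y q = 0"
    using assms d by (simp_all add: geodesic_iff)
  then have m: "m = - l * ?a / ?b" "m' = - l' * ?a / ?b"
    using lm(3)[of x y] lm'(3)[of x y] b by (simp_all add: field_simps)
  \<comment> \<open>The level for the pair \<open>(\<infinity>, \<infinity>)\<close> is the last coordinate, which is \<open>1\<close> at every point.\<close>
  define c where "c = side None None z - ?a / ?b * side None None w"
  have "level None None p = 1" "level None None q = 1"
    by (simp_all add: level_def)
  then have c1: "l * c = 1" "l' * c = 1"
    unfolding c_def using lm(3)[of None None] lm'(3)[of None None] unfolding m
    by (simp_all add: algebra_simps)
  then have "l = l'"
    by (metis mult_cancel_right mult_zero_right zero_neq_one)
  then have "m = m'"
    unfolding m by simp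
  then have "level a b p = level a b q" for a b
    using lm(3) lm'(3) \<open>l = l'\<close> by simp
  moreover have "Im p > 0" "Im q > 0"
    using assms d by (auto simp: geodesic_iff)
  ultimately show ?thesis
    by (intro complex_eq_if_levels_eq)
qed

lemma geodesic_eq_iff:
  assumes "x \<noteq> y" "z \<noteq> w"
  shows "geodesic x y = geodesic z w \<longleftrightarrow> {x, y} = {z, w}"
proof
  assume e: "geodesic x y = geodesic z w"
  show "{x, y} = {z, w}"
  proof -
    \<comment> \<open>Two points with different ratios of weights: if the form of \<open>x y\<close> vanishes at both, it vanishes at \<open>z\<close> and \<open>w\<close>.\<close>
    obtain p c where p: "p \<in> geodesic z w"
      "\<And>a b. c * level a b p = 1 * side a b z + 1 * side a b w"
      by (rule combination_is_geodesic_point[OF assms(2) zero_less_one zero_less_one]) (rule that)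
    obtain q c' where q: "q \<in> geodesic z w"
      "\<And>a b. c' * level a b q = 1 * side a b z + 2 * side a b w"
      by (rule combination_is_geodesic_point[OF assms(2) zero_less_one zero_less_numeral]) (rule that)
    have "level x y p = 0" "level x y q = 0"
      using p(1) q(1) assms(1) by (simp_all add: e[symmetric] geodesic_iff)
    then have "side x y z + side x y w = 0" "side x y z + 2 * side x y w = 0"
      using p(2)[of x y] q(2)[of x y] by simp_all
    then have "side x y z = 0" "side x y w = 0"
      by linarith+
    then show ?thesis
      using assms by (auto simp: doubleton_eq_iff)
  qed
next
  assume "{x, y} = {z, w}"
  then show "geodesic x y = geodesic z w"
    using assms geodesic_commute by (auto simp: doubleton_eq_iff)
qed

lemma card3_obtain:
  assumes "card V = 3" "x \<in> V" "y \<in> V" "x \<noteq> y"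
  obtains w where "V = {x, y, w}" "w \<noteq> x" "w \<noteq> y"
proof -
  have "finite V"
    using assms(1) by (simp add: card_ge_0_finite)
  then have "card (V - {x, y}) = 1"
    using assms by (simp add: card_Diff_subset)
  then obtain w where "V - {x, y} = {w}"
    by (auto simp: card_1_singleton_iff)
  then show ?thesis
    using that[of w] assms by blast
qed

lemma outside_vertex_linked:
  assumes "card V = 3" "x \<notin> V"
  obtains u v t where "V = {u, v, t}" "u \<noteq> v" "u \<noteq> t" "v \<noteq> t" "linked u v t x"
proof -
  obtain a b c where V: "V = {a, b, c}" "a \<noteq> b" "a \<noteq> c" "b \<noteq> c"
    using assms(1) by (auto simp: card_3_iff)
  have "x \<noteq> a" "x \<noteq> b" "x \<noteq> c"
    using assms(2) V(1) by auto
  then consider "linked a b c x" | "linked b c a x" | "linked a c b x"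
    using three_sides_of_triangle[OF V(2-4)] by blast
  then show ?thesis
  proof cases
    case 1 then show ?thesis using that[of a b c] V by blast
  next
    case 2 then show ?thesis using that[of b c a] V by (metis insert_commute)
  next
    case 3 then show ?thesis using that[of a c b] V by (metis insert_commute)
  qed
qed

text \<open>If an end \<open>x\<close> of the geodesic is not a vertex, it lies behind some side \<open>u v\<close>. A point of
the geodesic is a positive combination of its ends and lies on the triangle's side of \<open>u v\<close>, so the
other end must be strictly in front of \<open>u v\<close>.\<close>

lemma geodesic_through_triangle:
  assumes V: "card V = 3" and p: "p \<in> ideal_triangle V" "p \<in> geodesic x y" and xy: "x \<noteq> y"
  shows "{x, y} \<subseteq> V \<or> (\<exists>a\<in>V. \<exists>b\<in>V. linked x y a b)"
proof -
  have main: "\<exists>a\<in>V. \<exists>b\<in>V. linked x y a b"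
    if x: "x \<notin> V" and xy: "x \<noteq> y" and p2: "p \<in> geodesic x y" for x y
  proof -
    obtain u v t where V': "V = {u, v, t}" "u \<noteq> v" "u \<noteq> t" "v \<noteq> t" "linked u v t x"
      using outside_vertex_linked[OF V x] by blast
    obtain l m where lm: "l > 0" "m > 0" "\<And>a b. level a b p = l * side a b x + m * side a b y"
      by (rule geodesic_point_combination[OF xy p2]) (rule that)
    have s: "side u v x * side u v t < 0"
      using V'(5) by (simp add: linked_def mult.commute)
    have "0 \<le> level u v p * side u v t"
      using p(1) unfolding V'(1) ideal_triangle_iff[OF V'(2-4)] by blast
    also have "\<dots> = l * (side u v x * side u v t) + m * (side u v y * side u v t)"
      unfolding lm(3) by (simp add: algebra_simps)
    finally have "m * (side u v y * side u v t) > 0"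
      using s lm by (smt (verit) mult_pos_neg)
    then have "side u v y * side u v t > 0"
      using lm by (simp add: zero_less_mult_iff)
    then have "side u v x * side u v y < 0"
      using s by (auto simp: mult_less_0_iff zero_less_mult_iff)
    then have "linked x y u v"
      using linked_commute linked_def by blast
    then show ?thesis
      using V'(1) by blast
  qed
  have p3: "p \<in> geodesic y x"
    using p(2) geodesic_commute[OF xy] by simp
  show ?thesis
    using main[OF _ xy p(2)] main[OF _ xy[symmetric] p3] linked_swap1 by blast
qed

section \<open>Homeomorphisms of the circle at infinity\<close>

lemma topspace_Rhat [simp]: "topspace Rhat = UNIV"
  unfolding Rhat_def by (auto simp: UNIV_option_conv)

lemma openin_Rhat_Some: "open U \<Longrightarrow> openin Rhat (Some ` U)"
  unfolding Rhat_def by simp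

lemma openin_Rhat_None: "compact C \<Longrightarrow> openin Rhat (insert None (Some ` (- C)))"
  unfolding Rhat_def openin_Alexandroff_compactification
  by (auto simp: compact_imp_closed Compl_eq_Diff_UNIV)

text \<open>The two arcs between \<open>x\<close> and \<open>y\<close> are a bounded open interval and its exterior, or two
half-lines when one of the points is \<open>\<infinity>\<close>.\<close>

lemma arcs_cases:
  assumes "x \<noteq> y"
  obtains a b where "a < b" "{z. side x y z > 0} = insert None (Some ` (- {a..b}))"
      "{z. side x y z < 0} = Some ` {a<..<b}"
    | a where "{z. side x y z > 0} = Some ` {..<a}" "{z. side x y z < 0} = Some ` {a<..}"
proof -
  note arcs = that
  have real: thesis if "a < b" and s: "side x y = side (Some a) (Some b)" for a b
  proof (rule arcs(1)[OF \<open>a < b\<close>])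
    have n: "side x y None > 0"
      unfolding s by (simp add: side_def bracket_def)
    have p: "side x y (Some c) = (a - c) * (b - c)" for c
      unfolding s by (simp add: side_def bracket_def)
    have "z \<in> insert None (Some ` (- {a..b})) \<longleftrightarrow> side x y z > 0" for z
      using n \<open>a < b\<close> by (cases z) (auto simp: p zero_less_mult_iff)
    then show "{z. side x y z > 0} = insert None (Some ` (- {a..b}))"
      by blast
    have "z \<in> Some ` {a<..<b} \<longleftrightarrow> side x y z < 0" for z
      using n \<open>a < b\<close> by (cases z) (auto simp: p mult_less_0_iff)
    then show "{z. side x y z < 0} = Some ` {a<..<b}"
      by blast
  qed
  have inf: thesis if s: "side x y = side (Some a) None" for a
  proof (rule arcs(2))
    have p: "side x y (Some c) = a - c" "side x y None = 0" for c
      unfolding s by (simp_all add: side_def bracket_def)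
    have "z \<in> Some ` {..<a} \<longleftrightarrow> side x y z > 0" for z
      by (cases z) (auto simp: p)
    then show "{z. side x y z > 0} = Some ` {..<a}"
      by blast
    have "z \<in> Some ` {a<..} \<longleftrightarrow> side x y z < 0" for z
      by (cases z) (auto simp: p)
    then show "{z. side x y z < 0} = Some ` {a<..}"
      by blast
  qed
  show thesis
  proof (cases x; cases y)
    fix a b assume "x = Some a" "y = Some b"
    then show thesis
      using real[of a b] real[of b a] assms side_commute[of x y]
      by (metis linorder_neqE ext)
  next
    fix a assume "x = Some a" "y = None"
    then show thesis
      using inf[of a] by simp
  next
    fix a assume "x = None" "y = Some a"
    then show thesis
      using inf[of a] side_commute[of x y] by (metis ext)
  qed (use assms in auto)
qed

lemma arcs_open:
  assumes "x \<noteq> y"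
  shows "openin Rhat {z. side x y z > 0}" "openin Rhat {z. side x y z < 0}"
  by (rule arcs_cases[OF assms]; simp add: openin_Rhat_Some openin_Rhat_None)+

lemma connectedin_Rhat_Some:
  assumes "connected I"
  shows "connectedin Rhat (Some ` I)"
  unfolding Rhat_def
  by (rule connectedin_continuous_map_image[OF continuous_map_Some])
    (use assms in simp)

text \<open>Neighbourhoods of \<open>\<infinity>\<close> are complements of compact sets, so \<open>\<infinity>\<close> is in the closure
of every unbounded set.\<close>

lemma connectedin_Rhat_None:
  assumes "connected I" "\<not> bounded I"
  shows "connectedin Rhat (insert None (Some ` I))"
proof (rule connectedin_intermediate_closure_of[OF connectedin_Rhat_Some[OF assms(1)]])
  have "None \<in> Rhat closure_of (Some ` I)"
    unfolding in_closure_of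
  proof (intro conjI allI impI)
    fix U assume "None \<in> U \<and> openin Rhat U"
    then obtain C where C: "compact C" "U = insert None (Some ` (UNIV - C))"
      unfolding Rhat_def openin_Alexandroff_compactification by auto
    have "\<not> I \<subseteq> C"
      using assms(2) C(1) bounded_subset compact_imp_bounded by blast
    then show "\<exists>y. y \<in> Some ` I \<and> y \<in> U"
      using C(2) by blast
  qed simp
  then show "insert None (Some ` I) \<subseteq> Rhat closure_of Some ` I"
    by (simp add: closure_of_subset)
qed auto

text \<open>The exterior of an interval is the union of two unbounded half-lines, joined at \<open>\<infinity>\<close>.\<close>

lemma arcs_connected:
  assumes "x \<noteq> y"
  shows "connectedin Rhat {z. side x y z > 0}" "connectedin Rhat {z. side x y z < 0}"
proof -
  have unb: "\<not> bounded {..<a}" "\<not> bounded {a<..}" for a :: real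
  proof -
    have "\<not> (\<forall>x\<in>{..<a}. \<bar>x\<bar> \<le> B)" "\<not> (\<forall>x\<in>{a<..}. \<bar>x\<bar> \<le> B)" for B
    proof -
      have "- \<bar>a\<bar> - \<bar>B\<bar> - 1 \<in> {..<a}" "\<not> \<bar>- \<bar>a\<bar> - \<bar>B\<bar> - 1\<bar> \<le> B"
        "\<bar>a\<bar> + \<bar>B\<bar> + 1 \<in> {a<..}" "\<not> \<bar>\<bar>a\<bar> + \<bar>B\<bar> + 1\<bar> \<le> B"
        by auto
      then show "\<not> (\<forall>x\<in>{..<a}. \<bar>x\<bar> \<le> B)" "\<not> (\<forall>x\<in>{a<..}. \<bar>x\<bar> \<le> B)"
        by blast+
    qed
    then show "\<not> bounded {..<a}" "\<not> bounded {a<..}"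
      by (simp_all add: bounded_real)
  qed
  have out: "connectedin Rhat (insert None (Some ` (- {a..b})))" if "a < b" for a b
  proof -
    have "insert None (Some ` (- {a..b})) = insert None (Some ` {..<a}) \<union> insert None (Some ` {b<..})"
      using that by auto
    moreover have "connectedin Rhat (insert None (Some ` {..<a}) \<union> insert None (Some ` {b<..}))"
      by (intro connectedin_Un connectedin_Rhat_None unb) auto
    ultimately show ?thesis
      by simp
  qed
  show "connectedin Rhat {z. side x y z > 0}"
    by (rule arcs_cases[OF assms]) (auto intro!: out connectedin_Rhat_Some)
  show "connectedin Rhat {z. side x y z < 0}"
    by (rule arcs_cases[OF assms]) (auto intro!: connectedin_Rhat_Some)
qed

text \<open>The points \<open>z\<close> and \<open>w\<close> lie in one arc between \<open>x\<close> and \<open>y\<close>. Its image is connected and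
avoids \<open>h x\<close> and \<open>h y\<close>, so it cannot meet both of the disjoint open arcs between them.\<close>

lemma homeomorphism_not_linked:
  assumes h: "homeomorphic_map Rhat Rhat h" and xy: "x \<noteq> y"
    and zw: "side x y z * side x y w > 0"
  shows "\<not> linked (h x) (h y) (h z) (h w)"
proof
  assume l: "linked (h x) (h y) (h z) (h w)"
  have inj: "inj h"
    using homeomorphic_imp_injective_map[OF h] by simp
  obtain A where A: "connectedin Rhat A" "z \<in> A" "w \<in> A" "x \<notin> A" "y \<notin> A"
    using zw arcs_connected[OF xy] that[of "{z. side x y z > 0}"] that[of "{z. side x y z < 0}"]
    by (auto simp: zero_less_mult_iff)
  have c: "connectedin Rhat (h ` A)"
    using A(1) h connectedin_continuous_map_image homeomorphic_imp_continuous_map by blast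
  have hxy: "h x \<noteq> h y"
    using inj xy by (simp add: inj_eq)
  have sub: "h ` A \<subseteq> {v. side (h x) (h y) v > 0} \<union> {v. side (h x) (h y) v < 0}"
  proof
    fix v assume "v \<in> h ` A"
    then have "v \<noteq> h x" "v \<noteq> h y"
      using A inj by (auto simp: inj_eq)
    then have "side (h x) (h y) v \<noteq> 0"
      by simp
    then show "v \<in> {v. side (h x) (h y) v > 0} \<union> {v. side (h x) (h y) v < 0}"
      by (simp del: side_eq_0_iff) linarith
  qed
  have "{v. side (h x) (h y) v > 0} \<inter> h ` A \<noteq> {}" "{v. side (h x) (h y) v < 0} \<inter> h ` A \<noteq> {}"
    using l A(2,3) by (auto simp: linked_def mult_less_0_iff)
  moreover have "{v. side (h x) (h y) v > 0} \<inter> {v. side (h x) (h y) v < 0} \<inter> h ` A = {}"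
    by auto
  ultimately show False
    using connectedinD[OF c arcs_open[OF hxy] sub] by blast
qed

lemma homeomorphism_inverse:
  assumes "homeomorphic_map Rhat Rhat h"
  shows "bij h" "homeomorphic_map Rhat Rhat (inv_into UNIV h)"
proof -
  obtain g where g: "homeomorphic_maps Rhat Rhat h g"
    using assms homeomorphic_map_maps by blast
  then have gh: "g (h x) = x" "h (g x) = x" for x
    by (simp_all add: homeomorphic_maps_def)
  then show "bij h"
    by (intro bijI') metis+
  have "inv_into UNIV h = g"
    using gh by (metis inv_equality ext)
  moreover have "homeomorphic_map Rhat Rhat g"
    using g homeomorphic_maps_sym homeomorphic_map_maps by blast
  ultimately show "homeomorphic_map Rhat Rhat (inv_into UNIV h)"
    by simp
qed

lemma homeomorphism_linked_iff:
  assumes h: "homeomorphic_map Rhat Rhat h"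
  shows "linked (h x) (h y) (h z) (h w) \<longleftrightarrow> linked x y z w"
proof -
  have fwd: "linked x y z w" if h: "homeomorphic_map Rhat Rhat h" and l: "linked (h x) (h y) (h z) (h w)"
    for h x y z w
  proof -
    have "x \<noteq> y" "z \<noteq> x" "z \<noteq> y" "w \<noteq> x" "w \<noteq> y"
      using linked_distinct[OF l] by auto
    then have "side x y z * side x y w \<noteq> 0"
      by simp
    then show ?thesis
      using homeomorphism_not_linked[OF h \<open>x \<noteq> y\<close>, of z w] l unfolding linked_def
      by (metis linorder_neqE)
  qed
  have "inv_into UNIV h (h v) = v" for v
    using homeomorphism_inverse(1)[OF h] by (simp add: bij_is_inj)
  then show ?thesis
    using fwd[OF h] fwd[OF homeomorphism_inverse(2)[OF h], of "h x" "h y" "h z" "h w"] by auto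
qed

text \<open>Moving a point slightly up, and slightly to the right, must both keep \<open>level x y\<close> zero; these two
directions detect the coefficients of \<open>\<bar>z\<bar>\<^sup>2\<close> and \<open>Re z\<close>, which do not both vanish.\<close>

lemma open_subset_of_geodesic_empty:
  assumes "x \<noteq> y" "open A" "\<And>z. z \<in> A \<Longrightarrow> Im z > 0 \<and> level x y z = 0"
  shows "A = {}"
proof (rule ccontr)
  assume "A \<noteq> {}"
  then obtain z where z: "z \<in> A"
    by blast
  then obtain e where e: "e > 0" "ball z e \<subseteq> A"
    using assms(2) open_contains_ball by blast
  define d where "d = e / 2"
  have d: "d > 0" "z + of_real d \<in> A" "z + \<i> * of_real d \<in> A"
    using e unfolding d_def by (auto simp: dist_norm norm_mult intro!: subsetD[OF e(2)])
  note l = assms(3)[OF z] assms(3)[OF d(2)] assms(3)[OF d(3)]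
  have "level x y (z + \<i> * of_real d) - level x y z = d * (2 * Im z + d) * (hden x * hden y)"
    unfolding level_def by (simp add: power2_eq_square algebra_simps)
  then have den: "hden x * hden y = 0"
    using l d(1) by (smt (verit) mult_eq_0_iff)
  have "level x y (z + of_real d) - level x y z
      = - d * (hnum x * hden y + hden x * hnum y) + ((Re z + d)\<^sup>2 - (Re z)\<^sup>2) * (hden x * hden y)"
    unfolding level_def by (simp add: power2_eq_square algebra_simps)
  then have "hnum x * hden y + hden x * hnum y = 0"
    using l d(1) den by simp
  then show False
    using den assms(1) by (cases x; cases y) auto
qed

section \<open>Combinatorial triangulations\<close>

text \<open>Edges are ordered pairs, each edge occurring in both orientations; this costs a factor of at most two
in counting arguments.\<close>

definition edges :: "ideal_point set set \<Rightarrow> (ideal_point \<times> ideal_point) set" where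
  "edges VV = {(a, b). a \<noteq> b \<and> (\<exists>V\<in>VV. a \<in> V \<and> b \<in> V)}"

definition edge_geodesics :: "ideal_point set set \<Rightarrow> complex set set" where
  "edge_geodesics VV = (\<Union>V\<in>VV. sides V)"

lemma edgesI: "V \<in> VV \<Longrightarrow> a \<in> V \<Longrightarrow> b \<in> V \<Longrightarrow> a \<noteq> b \<Longrightarrow> (a, b) \<in> edges VV"
  by (auto simp: edges_def)

lemma edges_sym: "(a, b) \<in> edges VV \<Longrightarrow> (b, a) \<in> edges VV"
  by (auto simp: edges_def)

lemma edge_geodesics_eq: "edge_geodesics VV = {geodesic a b |a b. (a, b) \<in> edges VV}"
  unfolding edge_geodesics_def edges_def sides_def by blast

lemma geodesic_in_edge_geodesics_iff:
  assumes "x \<noteq> y"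
  shows "geodesic x y \<in> edge_geodesics VV \<longleftrightarrow> (x, y) \<in> edges VV"
proof
  assume "geodesic x y \<in> edge_geodesics VV"
  then obtain a b where ab: "(a, b) \<in> edges VV" "geodesic x y = geodesic a b"
    unfolding edge_geodesics_eq by blast
  then have "{x, y} = {a, b}"
    using geodesic_eq_iff[OF assms, of a b] by (simp add: edges_def)
  then show "(x, y) \<in> edges VV"
    using ab(1) edges_sym by (metis doubleton_eq_iff)
next
  assume "(x, y) \<in> edges VV"
  then show "geodesic x y \<in> edge_geodesics VV"
    unfolding edge_geodesics_eq by blast
qed

text \<open>A set of triples of ideal points that behaves like the set of triangles of a locally finite ideal
triangulation. Edges do not cross, every side of a triangle has a second triangle behind it, and
edges accumulate only at the diagonal, that is, only by shrinking to a point of the circle. All conditions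
are invariant under homeomorphisms of the circle.\<close>

locale combinatorial_triangulation =
  fixes VV :: "ideal_point set set"
  assumes nonempty: "VV \<noteq> {}"
    and card3: "V \<in> VV \<Longrightarrow> card V = 3"
    and not_linked: "(x, y) \<in> edges VV \<Longrightarrow> (z, w) \<in> edges VV \<Longrightarrow> \<not> linked x y z w"
    and neighbour: "{x, y, w} \<in> VV \<Longrightarrow> \<exists>w'. {x, y, w'} \<in> VV \<and> linked x y w w'"
    and discrete: "x \<noteq> y \<Longrightarrow> \<exists>U W. openin Rhat U \<and> openin Rhat W \<and> x \<in> U \<and> y \<in> W
      \<and> finite (edges VV \<inter> U \<times> W)"
begin

lemma triangle_distinct:
  assumes "{x, y, w} \<in> VV"
  shows "x \<noteq> y" "x \<noteq> w" "y \<noteq> w"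
  using card3[OF assms] by (auto simp: card_insert_if split: if_splits)

lemma triangle_edges:
  assumes "{x, y, w} \<in> VV"
  shows "(x, y) \<in> edges VV" "(x, w) \<in> edges VV" "(y, w) \<in> edges VV"
  using triangle_distinct[OF assms] by (simp_all add: edgesI[OF assms])

lemma vertices_edge_geodesics: "vertices (edge_geodesics VV) = \<Union>VV"
proof -
  have "(\<exists>y. x \<noteq> y \<and> geodesic x y \<in> edge_geodesics VV) \<longleftrightarrow> (\<exists>V\<in>VV. x \<in> V)" for x
  proof
    assume "\<exists>y. x \<noteq> y \<and> geodesic x y \<in> edge_geodesics VV"
    then show "\<exists>V\<in>VV. x \<in> V"
      using geodesic_in_edge_geodesics_iff by (auto simp: edges_def)
  next
    assume "\<exists>V\<in>VV. x \<in> V"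
    then obtain V where V: "V \<in> VV" "x \<in> V"
      by blast
    then have "V \<noteq> {x}"
      using card3 by force
    then obtain y where "y \<in> V" "y \<noteq> x"
      using V by blast
    then show "\<exists>y. x \<noteq> y \<and> geodesic x y \<in> edge_geodesics VV"
      using V geodesic_in_edge_geodesics_iff[of x y VV] by (auto simp: edges_def)
  qed
  then show ?thesis
    by (simp add: vertices_def set_eq_iff)
qed

text \<open>A vertex \<open>w\<close> of \<open>W\<close> that is not in \<open>V\<close> lies behind a side \<open>u v\<close> of \<open>V\<close>. Edges from
\<open>w\<close> cannot cross that side, so all of \<open>W\<close> lies behind it, and the two triangles share at most
points of the geodesic \<open>u v\<close>.\<close>

lemma interiors_disjoint:
  assumes V: "V \<in> VV" and W: "W \<in> VV" and "V \<noteq> W"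
  shows "interior (ideal_triangle V) \<inter> interior (ideal_triangle W) = {}"
proof -
  have "finite V"
    using card3[OF V] by (simp add: card_ge_0_finite)
  then have "\<not> W \<subseteq> V"
    using card3[OF V] card3[OF W] \<open>V \<noteq> W\<close> card_subset_eq by metis
  then obtain w where w: "w \<in> W" "w \<notin> V"
    by blast
  obtain u v t where uvt: "V = {u, v, t}" "u \<noteq> v" "u \<noteq> t" "v \<noteq> t" "linked u v t w"
    using outside_vertex_linked[OF card3[OF V] w(2)] by blast
  have tw: "side u v t * side u v w < 0"
    using uvt(5) by (simp add: linked_def)
  have W_side: "side u v q * side u v t \<le> 0" if "q \<in> W" for q
  proof (cases "q = w")
    case True
    then show ?thesis
      using tw by (simp add: mult.commute)
  next
    case False
    then have "(w, q) \<in> edges VV" "(u, v) \<in> edges VV"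
      using w that W V uvt(1,2) by (auto simp: edges_def)
    then have "side u v w * side u v q \<ge> 0"
      using not_linked by (force simp: linked_def)
    then show ?thesis
      using tw by (auto simp: zero_le_mult_iff mult_less_0_iff mult_le_0_iff)
  qed
  obtain p q r where pqr: "W = {p, q, r}" "p \<noteq> q" "p \<noteq> r" "q \<noteq> r"
    using card3[OF W] by (auto simp: card_3_iff)
  have "Im z > 0 \<and> level u v z = 0" if z: "z \<in> ideal_triangle V" "z \<in> ideal_triangle W" for z
  proof -
    have "level u v z * side u v t \<le> 0"
      using level_on_triangle_nonpos[OF pqr(2-4)] z(2) W_side unfolding pqr(1) by blast
    moreover have "Im z > 0" "level u v z * side u v t \<ge> 0"
      using z(1) unfolding uvt(1) ideal_triangle_iff[OF uvt(2-4)] by blast+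
    moreover have "side u v t \<noteq> 0"
      using uvt by simp
    ultimately show ?thesis
      by (metis mult_eq_0_iff order_antisym)
  qed
  then show ?thesis
    by (intro open_subset_of_geodesic_empty[OF uvt(2)]) (use interior_subset in blast)+
qed

end

text \<open>Near a real point the geodesics are small semicircles, which stay below any compact set; near
\<open>\<infinity>\<close> they are vertical lines far out, or semicircles that are far out or enclose a large disc.\<close>

lemma geodesics_near_ideal_point_avoid_compact:
  assumes K: "compact K" "K \<subseteq> upper_half_plane"
  obtains U where "openin Rhat U" "x \<in> U"
    "\<And>a b. a \<in> U \<Longrightarrow> b \<in> U \<Longrightarrow> a \<noteq> b \<Longrightarrow> geodesic a b \<inter> K = {}"
proof (cases x)
  case None
  obtain R where R: "R > 0" "\<And>z. z \<in> K \<Longrightarrow> cmod z \<le> R"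
    using compact_imp_bounded[OF K(1)] by (auto simp: bounded_pos)
  have "geodesic a b \<inter> K = {}"
    if ab: "a \<in> insert None (Some ` (- {-R..R}))" "b \<in> insert None (Some ` (- {-R..R}))" "a \<noteq> b"
    for a b
  proof (rule ccontr)
    assume "geodesic a b \<inter> K \<noteq> {}"
    then obtain z where z: "z \<in> geodesic a b" "z \<in> K"
      by blast
    have zR: "\<bar>Re z\<bar> \<le> R" "(Re z)\<^sup>2 + (Im z)\<^sup>2 \<le> R\<^sup>2"
      using R(2)[OF z(2)] abs_Re_le_cmod[of z] power_mono[of "cmod z" R 2]
      by (simp_all add: cmod_power2)
    have l: "Im z > 0" "level a b z = 0"
      using z(1) ab(3) by (simp_all add: geodesic_iff)
    have main: False if "p < q" "\<bar>p\<bar> > R" "\<bar>q\<bar> > R" "level (Some p) (Some q) z = 0" for p q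
    proof -
      have e: "(Re z - p) * (q - Re z) = (Im z)\<^sup>2"
        using that(4) by (simp add: level_def power2_eq_square algebra_simps)
      then have "(Re z - p) * (q - Re z) > 0"
        using l by simp
      then have "p < Re z" "Re z < q"
        using that(1) by (auto simp: zero_less_mult_iff)
      then have "p < - R" "q > R"
        using that zR by auto
      then have "(Re z + R) * (R - Re z) < (Re z - p) * (q - Re z)"
        using zR by (intro mult_strict_mono') auto
      then show False
        unfolding e using zR by (simp add: power2_eq_square algebra_simps)
    qed
    show False
    proof (cases a; cases b)
      fix p q assume pq: "a = Some p" "b = Some q"
      then have "\<bar>p\<bar> > R" "\<bar>q\<bar> > R" "p \<noteq> q"
        using ab by auto
      moreover have "level (Some p) (Some q) z = 0" "level (Some q) (Some p) z = 0"
        using l(2) level_commute[of a b] by (simp_all add: pq)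
      ultimately show False
        using main[of p q] main[of q p] by linarith
    qed (use ab l zR in \<open>auto simp: level_def\<close>)
  qed
  moreover have "openin Rhat (insert None (Some ` (- {-R..R})))"
    by (intro openin_Rhat_None) simp
  ultimately show ?thesis
    using that[of "insert None (Some ` (- {-R..R}))"] None by blast
next
  case (Some p)
  obtain e where e: "e > 0" "\<And>z. z \<in> K \<Longrightarrow> e \<le> Im z"
  proof (cases "K = {}")
    case False
    then obtain m where "m \<in> K" "\<And>z. z \<in> K \<Longrightarrow> Im m \<le> Im z"
      using continuous_attains_inf[OF K(1) False continuous_on_Im[OF continuous_on_id]] by auto
    then show ?thesis
      using that[of "Im m"] K(2) by (auto simp: upper_half_plane_def)
  qed (use that[of 1] in auto)
  have "geodesic a b \<inter> K = {}"
    if ab: "a \<in> Some ` {p - e / 2<..<p + e / 2}" "b \<in> Some ` {p - e / 2<..<p + e / 2}" "a \<noteq> b" for a b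
  proof (rule ccontr)
    assume "geodesic a b \<inter> K \<noteq> {}"
    then obtain z where z: "z \<in> geodesic a b" "z \<in> K"
      by blast
    obtain q r where qr: "a = Some q" "b = Some r"
        "q \<in> {p - e / 2<..<p + e / 2}" "r \<in> {p - e / 2<..<p + e / 2}"
      using ab by blast
    then have "\<bar>q - r\<bar> / 2 < e"
      by (simp add: abs_if)
    have l: "Im z > 0" "level a b z = 0"
      using z(1) ab(3) by (simp_all add: geodesic_iff)
    have "(Im z)\<^sup>2 \<le> (\<bar>q - r\<bar> / 2)\<^sup>2"
      using l(2) unfolding qr level_Some_Some by (smt (verit) zero_le_power2)
    then have "Im z \<le> \<bar>q - r\<bar> / 2"
      using l(1) by (simp add: power2_le_iff_abs_le)
    then show False
      using \<open>\<bar>q - r\<bar> / 2 < e\<close> e(2)[OF z(2)] by simp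
  qed
  then show ?thesis
    using that[of "Some ` {p - e / 2<..<p + e / 2}"] Some e(1) openin_Rhat_Some by auto
qed

context combinatorial_triangulation
begin

text \<open>Each point of the compact space of pairs of ideal points has a neighbourhood containing only finitely many
of the edges in question: off the diagonal by the discreteness of edges, on the diagonal because short
geodesics miss the compact set.\<close>

lemma finitely_many_edges_meet_compact:
  assumes K: "compact K" "K \<subseteq> upper_half_plane"
  shows "finite {(a, b) \<in> edges VV. geodesic a b \<inter> K \<noteq> {}}" (is "finite ?B")
proof -
  let ?X = "prod_topology Rhat Rhat"
  let ?C = "{W. openin ?X W \<and> finite (?B \<inter> W)}"
  have "\<exists>W\<in>?C. (x, y) \<in> W" for x y
  proof (cases "x = y")
    case True
    obtain U where U: "openin Rhat U" "x \<in> U"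
      "\<And>a b. a \<in> U \<Longrightarrow> b \<in> U \<Longrightarrow> a \<noteq> b \<Longrightarrow> geodesic a b \<inter> K = {}"
      by (rule geodesics_near_ideal_point_avoid_compact[OF K, of x]) (rule that)
    have "?B \<inter> U \<times> U = {}"
      using U(3) by (auto simp: edges_def)
    then have "U \<times> U \<in> ?C"
      using U by (simp add: openin_prod_Times_iff)
    then show ?thesis
      using U(2) True by (intro bexI[of _ "U \<times> U"]) simp_all
  next
    case False
    obtain U W where UW: "openin Rhat U" "openin Rhat W" "x \<in> U" "y \<in> W"
      "finite (edges VV \<inter> U \<times> W)"
      using discrete[OF False] by blast
    have "finite (?B \<inter> U \<times> W)"
      by (rule finite_subset[OF _ UW(5)]) auto
    then have "U \<times> W \<in> ?C"
      using UW by (simp add: openin_prod_Times_iff)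
    then show ?thesis
      using UW by (intro bexI[of _ "U \<times> W"]) simp_all
  qed
  then have cover: "topspace ?X \<subseteq> \<Union>?C"
    by auto
  have "compact_space ?X"
    by (simp add: compact_space_prod_topology Rhat_def)
  then obtain F where F: "finite F" "F \<subseteq> ?C" "topspace ?X \<subseteq> \<Union>F"
    using cover unfolding compact_space_alt by (metis (no_types, lifting) mem_Collect_eq)
  have "?B = (\<Union>W\<in>F. ?B \<inter> W)"
    using F(3) by auto
  also have "finite \<dots>"
    using F(1,2) by (intro finite_UN_I) auto
  finally show ?thesis .
qed

lemma locally_finite: "locally_finite_edges (edge_geodesics VV)"
  unfolding locally_finite_edges_def
proof (intro allI impI)
  fix K assume K: "compact K \<and> K \<subseteq> upper_half_plane"
  have "{E \<in> edge_geodesics VV. E \<inter> K \<noteq> {}}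
      \<subseteq> (\<lambda>(a, b). geodesic a b) ` {(a, b) \<in> edges VV. geodesic a b \<inter> K \<noteq> {}}"
    unfolding edge_geodesics_eq by auto
  then show "finite {E \<in> edge_geodesics VV. E \<inter> K \<noteq> {}}"
    using finitely_many_edges_meet_compact K finite_surj by blast
qed

end

section \<open>The triangles cover the half-plane\<close>

text \<open>The Euclidean segment serves here, since only continuity is at stake.\<close>

lemma level_zero_on_segment:
  assumes "level a b p * level a b z < 0"
  shows "\<exists>q\<in>closed_segment p z. level a b q = 0"
proof -
  have "continuous_on (closed_segment p z) (level a b)"
    unfolding level_def by (intro continuous_intros)
  then have c: "connected (level a b ` closed_segment p z)"
    by (intro connected_continuous_image) auto
  have m: "level a b p \<in> level a b ` closed_segment p z" "level a b z \<in> level a b ` closed_segment p z"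
    by auto
  have "0 \<in> level a b ` closed_segment p z"
    using assms connectedD_interval[OF c m] connectedD_interval[OF c m(2,1)]
    by (auto simp: mult_less_0_iff)
  then show ?thesis
    by (metis imageE)
qed

lemma point_inside_triangle:
  assumes "a \<noteq> b" "a \<noteq> c" "b \<noteq> c"
  obtains p where "Im p > 0" "level a b p * side a b c > 0" "level a c p * side a c b > 0"
    "level b c p * side b c a > 0"
proof -
  \<comment> \<open>The point \<open>p\<close> is represented by the sum of the vectors of the three vertices.\<close>
  let ?s = "(hnum a)\<^sup>2 + (hnum b)\<^sup>2 + (hnum c)\<^sup>2"
  let ?t = "hnum a * hden a + hnum b * hden b + hnum c * hden c"
  let ?u = "(hden a)\<^sup>2 + (hden b)\<^sup>2 + (hden c)\<^sup>2"
  have u: "?u > 0"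
    using assms by (cases a; cases b) (auto simp: add_pos_nonneg add_nonneg_pos)
  have "?s * ?u - ?t\<^sup>2 = (bracket a b)\<^sup>2 + (bracket a c)\<^sup>2 + (bracket b c)\<^sup>2"
    unfolding bracket_def by algebra
  also have "\<dots> > 0"
    using assms by (simp add: add_pos_nonneg)
  finally have "?s * ?u > ?t\<^sup>2"
    by simp
  then obtain p where p: "Im p > 0" "\<And>x y. ?u * level x y p
       = ?s * (hden x * hden y) - ?t * (hnum x * hden y + hden x * hnum y) + ?u * (hnum x * hnum y)"
    by (rule hyperbolic_point_exists[OF u]) (rule that)
  have e: "?u * level x y p = side x y a + side x y b + side x y c" for x y
    unfolding p(2) side_def bracket_def by algebra
  have pos: "level x y p * k > 0" if "?u * level x y p = k" "k \<noteq> 0" for x y k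
  proof -
    have "?u * (level x y p * k) = k\<^sup>2"
      using that(1) by (simp add: power2_eq_square)
    then show ?thesis
      using u that(2) by (metis zero_less_mult_pos zero_less_power2)
  qed
  show ?thesis
    by (rule that[OF p(1)]; rule pos) (use assms in \<open>simp_all add: e\<close>)
qed

text \<open>If the coordinate of \<open>z\<close> at \<open>w\<close> is negative, the coordinate at \<open>y\<close> is positive: a point behind the
side \<open>x y\<close> is in front of the side \<open>x w\<close>.\<close>

lemma third_side_separates:
  assumes d: "x \<noteq> y" "x \<noteq> w" "y \<noteq> w" and z: "Im z > 0"
    and xy: "level x y z * side x y w < 0"
  shows "level x w z * side x w y > 0"
proof -
  have pos: "l / s > 0 \<longleftrightarrow> l * s > 0" "l / s < 0 \<longleftrightarrow> l * s < 0" for l s :: real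
    by (auto simp: zero_less_mult_iff zero_less_divide_iff mult_less_0_iff divide_less_0_iff)
  have "level x y z / side x y w * (bracket x w)\<^sup>2 < 0"
    using xy d by (intro mult_neg_pos) (simp_all only: pos, simp)
  then have "level x w z / side x w y * (bracket x y)\<^sup>2 > 0"
    using level_self_pos[OF z, of x] level_at_vertex[OF d, of z] by linarith
  then have "level x w z / side x w y > 0"
    by (metis d(1) bracket_eq_0_iff zero_less_mult_pos2 zero_less_power2)
  then show ?thesis
    unfolding pos .
qed

text \<open>The quotient \<open>\<bar>level x y z\<bar> / \<bar>bracket x y\<bar>\<close> is \<open>Im z\<close> times the hyperbolic sine of
the distance from \<open>z\<close> to the geodesic \<open>x y\<close>. On the way to \<open>x y\<close> from a point behind \<open>x w\<close>, the side
\<open>x w\<close> comes first; analytically this is again the positivity of \<open>level x x z\<close>.\<close>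

lemma third_side_closer:
  assumes d: "x \<noteq> y" "x \<noteq> w" "y \<noteq> w" and z: "Im z > 0"
    and xy: "level x y z * side x y w > 0" and xw: "level x w z * side x w y < 0"
  shows "\<bar>level x w z\<bar> / \<bar>bracket x w\<bar> < \<bar>level x y z\<bar> / \<bar>bracket x y\<bar>"
proof -
  define X where "X = \<bar>bracket x y\<bar>"
  define Y where "Y = \<bar>bracket x w\<bar>"
  define Z where "Z = \<bar>bracket y w\<bar>"
  have p: "X > 0" "Y > 0" "Z > 0"
    using d by (simp_all add: X_def Y_def Z_def)
  have s: "\<bar>side x w y\<bar> = X * Z" "\<bar>side x y w\<bar> = Y * Z"
    using bracket_swap[of y w] by (simp_all add: side_def abs_mult X_def Y_def Z_def)
  have a: "level x w z / side x w y = - (\<bar>level x w z\<bar> / (X * Z))"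
    using xw unfolding s[symmetric] by (auto simp: mult_less_0_iff)
  have b: "level x y z / side x y w = \<bar>level x y z\<bar> / (Y * Z)"
    using xy unfolding s[symmetric] by (auto simp: zero_less_mult_iff)
  have "0 < - (\<bar>level x w z\<bar> / (X * Z)) * X\<^sup>2 + \<bar>level x y z\<bar> / (Y * Z) * Y\<^sup>2"
    using level_self_pos[OF z, of x] level_at_vertex[OF d, of z] unfolding a b
    by (simp add: X_def Y_def)
  then have "0 < (\<bar>level x y z\<bar> * Y - \<bar>level x w z\<bar> * X) / Z"
    using p by (simp add: power2_eq_square diff_divide_distrib)
  then have "\<bar>level x w z\<bar> * X < \<bar>level x y z\<bar> * Y"
    using p by (simp add: zero_less_divide_iff)
  then show ?thesis
    using p unfolding X_def[symmetric] Y_def[symmetric] by (simp add: field_simps)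
qed

context combinatorial_triangulation
begin

lemma finite_separating_edges:
  assumes "Im p > 0" "Im z > 0"
  shows "finite {(a, b) \<in> edges VV. level a b p * level a b z < 0}"
proof (rule finite_subset)
  have sub: "closed_segment p z \<subseteq> upper_half_plane"
    unfolding upper_half_plane_def using assms
    by (intro closed_segment_subset) (auto simp: convex_halfspace_Im_gt)
  show "finite {(a, b) \<in> edges VV. geodesic a b \<inter> closed_segment p z \<noteq> {}}"
    by (rule finitely_many_edges_meet_compact[OF _ sub]) simp
  show "{(a, b) \<in> edges VV. level a b p * level a b z < 0}
      \<subseteq> {(a, b) \<in> edges VV. geodesic a b \<inter> closed_segment p z \<noteq> {}}"
  proof clarify
    fix a b assume ab: "(a, b) \<in> edges VV" "level a b p * level a b z < 0"
      "geodesic a b \<inter> closed_segment p z = {}"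
    obtain q where q: "q \<in> closed_segment p z" "level a b q = 0"
      using level_zero_on_segment[OF ab(2)] by blast
    then have "q \<in> geodesic a b"
      using sub ab(1) by (auto simp: geodesic_iff edges_def upper_half_plane_def)
    then show False
      using ab(3) q(1) by blast
  qed
qed

lemma triangle_on_side:
  assumes "(x, y) \<in> edges VV" "c \<noteq> 0"
  obtains w where "{x, y, w} \<in> VV" "c * side x y w > 0"
proof -
  obtain V where V: "V \<in> VV" "x \<in> V" "y \<in> V" "x \<noteq> y"
    using assms(1) by (auto simp: edges_def)
  obtain w where w: "V = {x, y, w}" "w \<noteq> x" "w \<noteq> y"
    using card3_obtain[OF card3[OF V(1)] V(2-4)] by blast
  obtain w' where w': "{x, y, w'} \<in> VV" "linked x y w w'"
    using neighbour V(1) w(1) by blast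
  show ?thesis
  proof (cases "c * side x y w > 0")
    case True
    then show ?thesis
      using that V(1) w(1) by blast
  next
    case False
    then have "c * side x y w' > 0"
      using w'(2) assms(2) w(2,3) by (auto simp: linked_def zero_less_mult_iff mult_less_0_iff)
    then show ?thesis
      using that w'(1) by blast
  qed
qed

text \<open>Let \<open>p\<close> be an interior point of some triangle not containing \<open>z\<close>. Finitely many edges separate
\<open>p\<close> from \<open>z\<close>; let \<open>x y\<close> be one nearest to \<open>z\<close> and \<open>{x, y, w}\<close> the triangle on its
far side, where \<open>z\<close> is. If \<open>z\<close> were not in this triangle, it would be behind \<open>x w\<close> or \<open>y w\<close>, and that
edge would also separate \<open>p\<close> from \<open>z\<close> and be nearer.\<close>

lemma covers:
  assumes z: "Im z > 0"
  shows "\<exists>V\<in>VV. z \<in> ideal_triangle V"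
proof (rule ccontr)
  assume no: "\<not> ?thesis"
  obtain a b c where abc: "{a, b, c} \<in> VV" "a \<noteq> b" "a \<noteq> c" "b \<noteq> c"
    using nonempty card3 by (metis card_3_iff ex_in_conv)
  obtain p where p: "Im p > 0" "level a b p * side a b c > 0" "level a c p * side a c b > 0"
    "level b c p * side b c a > 0"
    by (rule point_inside_triangle[OF abc(2-4)]) (rule that)
  define S where "S = {(a, b) \<in> edges VV. level a b p * level a b z < 0}"
  have opp: "l * l' < 0" if "l * s > 0" "\<not> l' * s \<ge> 0" for l l' s :: real
    using that by (auto simp: zero_less_mult_iff mult_less_0_iff not_le)
  have "z \<notin> ideal_triangle {a, b, c}"
    using no abc(1) by blast
  then have "\<not> level a b z * side a b c \<ge> 0 \<or> \<not> level a c z * side a c b \<ge> 0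
      \<or> \<not> level b c z * side b c a \<ge> 0"
    unfolding ideal_triangle_iff[OF abc(2-4)] using z by blast
  then have "level a b p * level a b z < 0 \<or> level a c p * level a c z < 0
      \<or> level b c p * level b c z < 0"
    using opp[OF p(2), of "level a b z"] opp[OF p(3), of "level a c z"]
      opp[OF p(4), of "level b c z"] by argo
  then have "(a, b) \<in> S \<or> (a, c) \<in> S \<or> (b, c) \<in> S"
    by (simp add: S_def triangle_edges[OF abc(1)])
  then have S: "finite S" "S \<noteq> {}"
    using finite_separating_edges[OF p(1) z] by (auto simp: S_def)
  \<comment> \<open>A monotone function of the hyperbolic distance from \<open>z\<close> to the edge.\<close>
  define f where "f = (\<lambda>(a, b). \<bar>level a b z\<bar> / \<bar>bracket a b\<bar>)"
  obtain x y where xy: "(x, y) \<in> S" "\<And>e. e \<in> S \<Longrightarrow> \<not> f e < f (x, y)"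
    using arg_min_if_finite[OF S, of f] by (metis surj_pair)
  then have e: "(x, y) \<in> edges VV" and s: "level x y p * level x y z < 0"
    by (auto simp: S_def)
  obtain w where w: "{x, y, w} \<in> VV" "level x y z * side x y w > 0"
    using triangle_on_side[OF e, of "level x y z"] s by (metis mult_zero_right less_irrefl)
  have main: "level x w z * side x w y \<ge> 0"
    if m: "\<And>e. e \<in> S \<Longrightarrow> \<not> f e < f (x, y)" and s: "level x y p * level x y z < 0"
      and w: "{x, y, w} \<in> VV" "level x y z * side x y w > 0" for x y
  proof (rule ccontr)
    assume n: "\<not> ?thesis"
    note d = triangle_distinct[OF w(1)]
    have "level x y p * side x y w < 0"
      using s w(2) by (auto simp: zero_less_mult_iff mult_less_0_iff)
    then have "level x w p * side x w y > 0"
      by (rule third_side_separates[OF d p(1)])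
    then have "level x w p * level x w z < 0"
      using opp n by blast
    then have "(x, w) \<in> S"
      by (simp add: S_def triangle_edges[OF w(1)])
    moreover have "f (x, w) < f (x, y)"
      unfolding f_def using third_side_closer[OF d z w(2)] n by simp
    ultimately show False
      using m by blast
  qed
  have "f (y, x) = f (x, y)"
    by (simp add: f_def level_commute[of y x] bracket_swap[of y x])
  then have "level y w z * side y w x \<ge> 0"
    using xy(2) s w by (intro main) (simp_all add: level_commute[of y x] side_commute[of y x] insert_commute)
  then have "z \<in> ideal_triangle {x, y, w}"
    unfolding ideal_triangle_iff[OF triangle_distinct[OF w(1)]]
    using z w(2) main[OF xy(2) s w] by simp
  then show False
    using no w(1) by blast
qed

lemma ideal_triangulation: "ideal_triangulation (edge_geodesics VV)"
  unfolding ideal_triangulation_def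
proof (intro exI conjI)
  show "\<forall>V\<in>VV. card V = 3"
    using card3 by blast
  show "pairwise (\<lambda>V W. interior (ideal_triangle V) \<inter> interior (ideal_triangle W) = {}) VV"
    using interiors_disjoint by (auto simp: pairwise_def)
  show "edge_geodesics VV = (\<Union>V\<in>VV. sides V)"
    by (simp add: edge_geodesics_def)
  show "(\<Union>V\<in>VV. ideal_triangle V) = upper_half_plane"
  proof
    show "(\<Union>V\<in>VV. ideal_triangle V) \<subseteq> upper_half_plane"
    proof clarify
      fix V z assume "V \<in> VV" "z \<in> ideal_triangle V"
      then show "z \<in> upper_half_plane"
        using card3[of V] by (auto simp: card_3_iff ideal_triangle_iff upper_half_plane_def)
    qed
    show "upper_half_plane \<subseteq> (\<Union>V\<in>VV. ideal_triangle V)"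
      using covers by (auto simp: upper_half_plane_def)
  qed
qed

lemma allowable:
  assumes "\<Union>VV = Qhat"
  shows "allowable (edge_geodesics VV)"
  unfolding allowable_def
  using ideal_triangulation locally_finite vertices_edge_geodesics assms by simp

text \<open>Two different triangles on the same side of the edge \<open>a b\<close> would have crossing sides.\<close>

lemma triangles_on_edge:
  assumes "a \<noteq> b"
  shows "finite {V \<in> VV. a \<in> V \<and> b \<in> V}" "card {V \<in> VV. a \<in> V \<and> b \<in> V} \<le> 2"
proof -
  let ?P = "\<lambda>k::real. {V \<in> VV. \<exists>w. V = {a, b, w} \<and> k * side a b w > 0}"
  have eq: "V = W" if VW: "V \<in> ?P k" "W \<in> ?P k" for V W k
  proof -
    obtain v w where vw: "V = {a, b, v}" "W = {a, b, w}" "k * side a b v > 0" "k * side a b w > 0"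
      using VW by blast
    have V: "{a, b, v} \<in> VV" and W: "{a, b, w} \<in> VV"
      using VW vw by auto
    show ?thesis
    proof (rule ccontr)
      assume "V \<noteq> W"
      then have "w \<noteq> v"
        using vw by blast
      note d = triangle_distinct[OF V] triangle_distinct[OF W]
      have "\<not> linked a b v w"
        using vw by (auto simp: linked_def zero_less_mult_iff mult_less_0_iff)
      then have "linked b v a w \<or> linked a v b w"
        using three_sides_of_triangle[of a b v w] d \<open>w \<noteq> v\<close> by auto
      then show False
        using not_linked[OF triangle_edges(3)[OF V] triangle_edges(2)[OF W]]
          not_linked[OF triangle_edges(2)[OF V] triangle_edges(3)[OF W]] by blast
    qed
  qed
  have P: "finite (?P k) \<and> card (?P k) \<le> 1" for k
  proof (cases "?P k = {}")
    case False
    then obtain V where "V \<in> ?P k"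
      by blast
    then have "?P k = {V}"
      using eq by blast
    then show ?thesis
      by (metis One_nat_def card.empty card_insert_disjoint empty_iff finite.emptyI finite.insertI order_refl)
  qed (metis card.empty finite.emptyI zero_le)
  have sub: "{V \<in> VV. a \<in> V \<and> b \<in> V} \<subseteq> ?P 1 \<union> ?P (- 1)"
  proof clarify
    fix V assume V: "V \<in> VV" "a \<in> V" "b \<in> V"
      and n: "\<not> (\<exists>w. V = {a, b, w} \<and> - 1 * side a b w > 0)"
    obtain w where w: "V = {a, b, w}" "w \<noteq> a" "w \<noteq> b"
      using card3_obtain[OF card3[OF V(1)] V(2,3) assms] by blast
    then have "side a b w \<noteq> 0"
      by simp
    then have "1 * side a b w > 0"
      using n w(1) by (simp del: side_eq_0_iff) (metis linorder_neqE)
    then show "\<exists>w. V = {a, b, w} \<and> 1 * side a b w > 0"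
      using w(1) by blast
  qed
  have fin: "finite (?P 1 \<union> ?P (- 1))"
    using P by (simp only: finite_Un)
  show "finite {V \<in> VV. a \<in> V \<and> b \<in> V}"
    by (rule finite_subset[OF sub fin])
  have "card {V \<in> VV. a \<in> V \<and> b \<in> V} \<le> card (?P 1 \<union> ?P (- 1))"
    by (rule card_mono[OF fin sub])
  also have "\<dots> \<le> card (?P 1) + card (?P (- 1))"
    by (rule card_Un_le)
  also have "\<dots> \<le> 2"
    using P[of 1] P[of "- 1"] by linarith
  finally show "card {V \<in> VV. a \<in> V \<and> b \<in> V} \<le> 2" .
qed

end

section \<open>Reflections given by integer matrices\<close>

text \<open>The action on ideal points of the matrix with rows \<open>(a, b)\<close> and \<open>(c, -a)\<close>. With
determinant \<open>-1\<close> and trace \<open>0\<close> such a matrix is an involution, and on the half-plane it acts by a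
hyperbolic reflection (\<open>plane_flip\<close>).\<close>

fun flip :: "int \<Rightarrow> int \<Rightarrow> int \<Rightarrow> ideal_point \<Rightarrow> ideal_point" where
  "flip a b c (Some x) = (if c * x = a then None else Some ((a * x + b) / (c * x - a)))"
| "flip a b c None = (if c = 0 then None else Some (a / c))"

definition plane_flip :: "int \<Rightarrow> int \<Rightarrow> int \<Rightarrow> complex \<Rightarrow> complex" where
  "plane_flip a b c z = (of_int a * cnj z + of_int b) / (of_int c * cnj z - of_int a)"

lemma of_int_det:
  assumes "a * a + b * c = (1::int)"
  shows "of_int a * of_int a + of_int b * of_int c = (1 :: 'a :: ring_1)"
  using assms by (metis of_int_1 of_int_add of_int_mult)

text \<open>The scale factor \<open>k\<close> allows all properties of \<open>flip\<close> to be read off from the matrix without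
distinguishing the cases of its definition.\<close>

lemma flip_coordinates:
  assumes "a * a + b * c = 1"
  obtains k where "k \<noteq> 0" "k * hnum (flip a b c x) = a * hnum x + b * hden x"
    "k * hden (flip a b c x) = c * hnum x - a * hden x"
proof -
  have det: "real_of_int a * of_int a + of_int b * of_int c = 1"
    by (rule of_int_det) (rule assms)
  show ?thesis
  proof (cases x)
    case None
    show ?thesis
    proof (cases "c = 0")
      case True
      then have "a \<noteq> 0"
        using det by auto
      then show ?thesis
        using that[of a] None True by simp
    next
      case False
      then show ?thesis
        using that[of c] None by auto
    qed
  next
    case (Some t)
    show ?thesis
    proof (cases "c * t = a")
      case True
      have "c * (a * t + b) = a * (c * t) + real_of_int b * c"
        by (simp add: algebra_simps)
      then have "c * (a * t + b) = 1"
        unfolding True using det by simp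
      then have "a * t + b \<noteq> 0"
        by auto
      then show ?thesis
        using that[of "a * t + b"] True Some by auto
    next
      case False
      then show ?thesis
        using that[of "c * t - a"] Some by auto
    qed
  qed
qed

lemma flip_bracket:
  fixes a b c :: int
  assumes "a * a + b * c = 1"
    and x: "k * hnum x' = a * hnum x + b * hden x" "k * hden x' = c * hnum x - a * hden x"
    and y: "l * hnum y' = a * hnum y + b * hden y" "l * hden y' = c * hnum y - a * hden y"
  shows "k * l * bracket x' y' = - bracket x y"
proof -
  have det: "real_of_int a * of_int a + of_int b * of_int c = 1"
    by (rule of_int_det) (rule assms)
  have "k * l * bracket x' y' = (k * hnum x') * (l * hden y') - (l * hnum y') * (k * hden x')"
    unfolding bracket_def by algebra
  also have "\<dots> = - (real_of_int a * of_int a + of_int b * of_int c) * bracket x y"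
    unfolding x y bracket_def by algebra
  finally show ?thesis
    unfolding det by simp
qed

text \<open>All brackets are multiplied by the determinant, up to scale factors that enter \<open>linked\<close>
through a square.\<close>

lemma flip_linked:
  assumes det: "a * a + b * c = 1"
  shows "linked (flip a b c x) (flip a b c y) (flip a b c z) (flip a b c w) \<longleftrightarrow> linked x y z w"
proof -
  let ?f = "flip a b c"
  obtain k where k: "k \<noteq> 0" "k * hnum (?f x) = a * hnum x + b * hden x"
    "k * hden (?f x) = c * hnum x - a * hden x" by (rule flip_coordinates[OF det])
  obtain l where l: "l \<noteq> 0" "l * hnum (?f y) = a * hnum y + b * hden y"
    "l * hden (?f y) = c * hnum y - a * hden y" by (rule flip_coordinates[OF det])
  obtain m where m: "m \<noteq> 0" "m * hnum (?f z) = a * hnum z + b * hden z"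
    "m * hden (?f z) = c * hnum z - a * hden z" by (rule flip_coordinates[OF det])
  obtain n where n: "n \<noteq> 0" "n * hnum (?f w) = a * hnum w + b * hden w"
    "n * hden (?f w) = c * hnum w - a * hden w" by (rule flip_coordinates[OF det])
  note br = flip_bracket[OF det]
  have "side x y z * side x y w = (- bracket x z) * (- bracket y z) * ((- bracket x w) * (- bracket y w))"
    by (simp add: side_def)
  also have "\<dots> = (k * l * m * n)\<^sup>2 * (side (?f x) (?f y) (?f z) * side (?f x) (?f y) (?f w))"
    unfolding br[OF k(2,3) m(2,3), symmetric] br[OF l(2,3) m(2,3), symmetric]
      br[OF k(2,3) n(2,3), symmetric] br[OF l(2,3) n(2,3), symmetric] side_def
    by (simp add: power2_eq_square algebra_simps)
  finally show ?thesis
    using k(1) l(1) m(1) n(1) by (simp add: linked_def mult_less_0_iff)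
qed

lemma flip_flip:
  assumes det: "a * a + b * c = 1"
  shows "flip a b c (flip a b c x) = x"
proof -
  let ?f = "flip a b c"
  obtain k where k: "k \<noteq> 0" "k * hnum (?f x) = a * hnum x + b * hden x"
    "k * hden (?f x) = c * hnum x - a * hden x" by (rule flip_coordinates[OF det])
  obtain l where l: "l \<noteq> 0" "l * hnum (?f (?f x)) = a * hnum (?f x) + b * hden (?f x)"
    "l * hden (?f (?f x)) = c * hnum (?f x) - a * hden (?f x)" by (rule flip_coordinates[OF det])
  have "k * l * bracket (?f (?f x)) x
      = (a * (k * hnum (?f x)) + b * (k * hden (?f x))) * hden x
        - hnum x * (c * (k * hnum (?f x)) - a * (k * hden (?f x)))"
    using l(2,3) unfolding bracket_def by algebra
  also have "\<dots> = 0"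
    unfolding k by algebra
  finally show ?thesis
    using k(1) l(1) by simp
qed

lemma inj_flip: "a * a + b * c = 1 \<Longrightarrow> inj (flip a b c)"
  by (metis flip_flip injI)

text \<open>The matrix acts on the vectors \<open>(\<bar>z\<bar>\<^sup>2, Re z, 1)\<close>, up to the positive factor \<open>N\<close>, by its symmetric
square, just as it does on ideal points; so it carries the plane of \<open>x y\<close> to that of the image pair.\<close>

lemma plane_flip_level:
  assumes det: "a * a + b * c = 1" and z: "Im z > 0"
  shows "Im (plane_flip a b c z) > 0"
    and "level (flip a b c x) (flip a b c y) (plane_flip a b c z) = 0 \<longleftrightarrow> level x y z = 0"
proof -
  have r: "real_of_int a * of_int a + of_int b * of_int c = 1"
    by (rule of_int_det) (rule assms)
  let ?t = "Re z" and ?v = "Im z" and ?z = "plane_flip a b c z"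
  define N where "N = (c * ?t - a)\<^sup>2 + (c * ?v)\<^sup>2"
  have N: "N > 0"
  proof (cases "c = 0")
    case True
    then show ?thesis
      using r by (auto simp: N_def)
  next
    case False
    then show ?thesis
      using z by (simp add: N_def add_nonneg_pos)
  qed
  have Re: "Re ?z = ((a * ?t + b) * (c * ?t - a) + real_of_int a * of_int c * ?v\<^sup>2) / N"
    unfolding plane_flip_def N_def by (simp add: Re_divide power2_eq_square algebra_simps)
  have "Im ?z = ?v * (real_of_int a * of_int a + of_int b * of_int c) / N"
    unfolding plane_flip_def N_def by (simp add: Im_divide power2_eq_square algebra_simps)
  then have Im: "Im ?z = ?v / N"
    unfolding r by simp
  show "Im ?z > 0"
    unfolding Im using z N by simp
  have "((a * ?t + b) * (c * ?t - a) + real_of_int a * of_int c * ?v\<^sup>2)\<^sup>2 + (?v * (real_of_int a * of_int a + of_int b * of_int c))\<^sup>2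
      = ((a * ?t + b)\<^sup>2 + (a * ?v)\<^sup>2) * N"
    unfolding N_def by algebra
  then have sq: "(Re ?z)\<^sup>2 + (Im ?z)\<^sup>2 = ((a * ?t + b)\<^sup>2 + (a * ?v)\<^sup>2) / N"
    unfolding Re Im r using N
    by (simp add: power_divide add_divide_distrib[symmetric] power2_eq_square[of N])
  obtain k where k: "k \<noteq> 0" "k * hnum (flip a b c x) = a * hnum x + b * hden x"
    "k * hden (flip a b c x) = c * hnum x - a * hden x" by (rule flip_coordinates[OF det])
  obtain l where l: "l \<noteq> 0" "l * hnum (flip a b c y) = a * hnum y + b * hden y"
    "l * hden (flip a b c y) = c * hnum y - a * hden y" by (rule flip_coordinates[OF det])
  let ?hx = "hnum (flip a b c x)" and ?dx = "hden (flip a b c x)"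
    and ?hy = "hnum (flip a b c y)" and ?dy = "hden (flip a b c y)"
  have clear: "N * (A / N * D - B / N * H + G) = A * D - B * H + N * G" for A B D G H
    using N by (simp add: field_simps)
  have "N * level (flip a b c x) (flip a b c y) ?z = ((a * ?t + b)\<^sup>2 + (a * ?v)\<^sup>2) * (?dx * ?dy)
      - ((a * ?t + b) * (c * ?t - a) + real_of_int a * of_int c * ?v\<^sup>2) * (?hx * ?dy + ?dx * ?hy) + N * (?hx * ?hy)"
    unfolding level_def sq unfolding Re by (rule clear)
  then have "k * l * (N * level (flip a b c x) (flip a b c y) ?z)
      = ((a * ?t + b)\<^sup>2 + (a * ?v)\<^sup>2) * ((k * ?dx) * (l * ?dy))
      - ((a * ?t + b) * (c * ?t - a) + real_of_int a * of_int c * ?v\<^sup>2) * ((k * ?hx) * (l * ?dy) + (k * ?dx) * (l * ?hy))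
      + N * ((k * ?hx) * (l * ?hy))"
    by algebra
  also have "\<dots> = (real_of_int a * of_int a + of_int b * of_int c)\<^sup>2 * level x y z"
    unfolding k l N_def level_def by algebra
  finally show "level (flip a b c x) (flip a b c y) ?z = 0 \<longleftrightarrow> level x y z = 0"
    unfolding r using k(1) l(1) N by auto
qed

lemma plane_flip_plane_flip:
  assumes det: "a * a + b * c = 1" and z: "Im z > 0"
  shows "plane_flip a b c (plane_flip a b c z) = z"
proof -
  have r: "complex_of_int a * of_int a + of_int b * of_int c = 1"
    by (rule of_int_det) (rule assms)
  have n: "complex_of_int c * z - a \<noteq> 0"
  proof
    assume e: "complex_of_int c * z - a = 0"
    then have "Im (complex_of_int c * z - a) = 0"
      by simp
    then have "c = 0"
      using z by simp
    then show False
      using e r by simp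
  qed
  have cn: "cnj (plane_flip a b c z) = (of_int a * z + of_int b) / (of_int c * z - of_int a)"
    by (simp add: plane_flip_def)
  have frac: "A * (B / D) + C = (A * B + C * D) / D" if "D \<noteq> 0" for A B C D :: complex
    using that by (simp add: field_simps)
  have "of_int a * cnj (plane_flip a b c z) + of_int b = (of_int a * (of_int a * z + of_int b)
      + of_int b * (of_int c * z - of_int a)) / (of_int c * z - of_int a)"
    unfolding cn by (rule frac[OF n])
  also have "of_int a * (of_int a * z + of_int b) + of_int b * (of_int c * z - of_int a)
      = (of_int a * of_int a + of_int b * of_int c) * z"
    by algebra
  finally have 1: "of_int a * cnj (plane_flip a b c z) + of_int b = z / (of_int c * z - of_int a)"
    unfolding r by simp
  have "of_int c * cnj (plane_flip a b c z) - of_int a = (of_int c * (of_int a * z + of_int b)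
      - of_int a * (of_int c * z - of_int a)) / (of_int c * z - of_int a)"
    unfolding cn using frac[OF n, of "of_int c" _ "- of_int a"] by simp
  also have "of_int c * (of_int a * z + of_int b) - of_int a * (of_int c * z - of_int a)
      = of_int a * of_int a + of_int b * of_int c"
    by algebra
  finally have 2: "of_int c * cnj (plane_flip a b c z) - of_int a = 1 / (of_int c * z - of_int a)"
    unfolding r .
  show ?thesis
    unfolding plane_flip_def[of a b c "plane_flip a b c z"] 1 2 using n by simp
qed

lemma plane_flip_geodesic:
  assumes det: "a * a + b * c = 1" and "x \<noteq> y"
  shows "plane_flip a b c ` geodesic x y = geodesic (flip a b c x) (flip a b c y)"
proof -
  have sub: "plane_flip a b c ` geodesic x y \<subseteq> geodesic (flip a b c x) (flip a b c y)"
    if "x \<noteq> y" for x y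
    using plane_flip_level[OF det] that inj_flip[OF det] by (auto simp: geodesic_iff inj_eq)
  have ne: "flip a b c x \<noteq> flip a b c y"
    using assms inj_flip by (auto simp: inj_eq)
  have "z \<in> plane_flip a b c ` geodesic x y" if z: "z \<in> geodesic (flip a b c x) (flip a b c y)" for z
  proof -
    have "plane_flip a b c z \<in> geodesic x y"
      using sub[OF ne] z by (auto simp: flip_flip[OF det])
    moreover have "plane_flip a b c (plane_flip a b c z) = z"
      using z ne by (intro plane_flip_plane_flip[OF det]) (simp add: geodesic_iff)
    ultimately show ?thesis
      by (metis imageI)
  qed
  then show ?thesis
    using sub[OF assms(2)] by blast
qed

text \<open>The reflections in the sides \<open>0 \<infinity>\<close>, \<open>1 \<infinity>\<close> and \<open>0 1\<close> of the basic triangle.\<close>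

definition basic_flips :: "(int \<times> int \<times> int) set" where
  "basic_flips = {(-1, 0, 0), (-1, 2, 0), (1, 0, 2)}"

lemma basic_flips_det: "(a, b, c) \<in> basic_flips \<Longrightarrow> a * a + b * c = 1"
  by (auto simp: basic_flips_def)

lemma reflections_eq_flips:
  "{restrict (reflection x y) upper_half_plane | x y.
        x \<in> basic_vertices \<and> y \<in> basic_vertices \<and> x \<noteq> y}
    = {restrict (plane_flip a b c) upper_half_plane | a b c. (a, b, c) \<in> basic_flips}"
proof -
  have a: "reflection (Some 0) None z = plane_flip (-1) 0 0 z"
    "reflection None (Some 0) z = plane_flip (-1) 0 0 z"
    "reflection (Some 1) None z = plane_flip (-1) 2 0 z"
    "reflection None (Some 1) z = plane_flip (-1) 2 0 z" for z
    by (simp_all add: plane_flip_def)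
  have b: "reflection (Some 0) (Some 1) z = plane_flip 1 0 2 z"
    "reflection (Some 1) (Some 0) z = plane_flip 1 0 2 z" if "z \<in> upper_half_plane" for z
  proof -
    have "Im (2 * cnj z - 1) \<noteq> 0"
      using that by (simp add: upper_half_plane_def)
    then have n: "2 * cnj z - 1 \<noteq> 0"
      by (metis zero_complex.simps(2))
    have "1 / 2 + (1 / 4) / (cnj z - 1 / 2) = cnj z / (2 * cnj z - 1)"
      using n by (simp add: divide_simps)
    then show "reflection (Some 0) (Some 1) z = plane_flip 1 0 2 z"
      "reflection (Some 1) (Some 0) z = plane_flip 1 0 2 z"
      by (simp_all add: plane_flip_def power2_eq_square)
  qed
  have R: "restrict (reflection (Some 0) None) upper_half_plane = restrict (plane_flip (-1) 0 0) upper_half_plane"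
    "restrict (reflection None (Some 0)) upper_half_plane = restrict (plane_flip (-1) 0 0) upper_half_plane"
    "restrict (reflection (Some 1) None) upper_half_plane = restrict (plane_flip (-1) 2 0) upper_half_plane"
    "restrict (reflection None (Some 1)) upper_half_plane = restrict (plane_flip (-1) 2 0) upper_half_plane"
    "restrict (reflection (Some 0) (Some 1)) upper_half_plane = restrict (plane_flip 1 0 2) upper_half_plane"
    "restrict (reflection (Some 1) (Some 0)) upper_half_plane = restrict (plane_flip 1 0 2) upper_half_plane"
    using a b by (auto simp: restrict_def)
  have "{restrict (reflection x y) upper_half_plane | x y.
        x \<in> basic_vertices \<and> y \<in> basic_vertices \<and> x \<noteq> y}
    = (\<lambda>(x, y). restrict (reflection x y) upper_half_plane) `
       {(x, y). x \<in> basic_vertices \<and> y \<in> basic_vertices \<and> x \<noteq> y}"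
    by auto
  also have "{(x, y). x \<in> basic_vertices \<and> y \<in> basic_vertices \<and> x \<noteq> y}
    = {(Some 0, None), (None, Some 0), (Some 1, None), (None, Some 1), (Some 0, Some 1), (Some 1, Some 0)}"
    unfolding basic_vertices_def by auto
  also have "(\<lambda>(x, y). restrict (reflection x y) upper_half_plane) ` \<dots>
    = (\<lambda>(a, b, c). restrict (plane_flip a b c) upper_half_plane) ` basic_flips"
    unfolding basic_flips_def image_insert image_empty prod.case R by auto
  also have "\<dots> = {restrict (plane_flip a b c) upper_half_plane | a b c. (a, b, c) \<in> basic_flips}"
    by (auto intro: rev_image_eqI)
  finally show ?thesis .
qed

section \<open>The Farey triangles as an orbit\<close>

text \<open>The orbit of the basic triangle, described by its vertices. It is generated on the ideal boundary alone,
which makes induction on triangles possible without the group of plane maps.\<close>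

inductive_set farey_triangles :: "ideal_point set set" where
  base: "basic_vertices \<in> farey_triangles"
| step: "V \<in> farey_triangles \<Longrightarrow> (a, b, c) \<in> basic_flips \<Longrightarrow> flip a b c ` V \<in> farey_triangles"

lemma geodesic_subset: "x \<noteq> y \<Longrightarrow> geodesic x y \<subseteq> upper_half_plane"
  by (auto simp: geodesic_iff upper_half_plane_def)

lemma image_restrict_subset: "E \<subseteq> A \<Longrightarrow> restrict f A ` E = f ` E"
  by (intro image_cong) auto

lemma image_compose_subset: "E \<subseteq> A \<Longrightarrow> compose A f g ` E = f ` (g ` E)"
  by (simp only: compose_def image_restrict_subset image_image)

lemma sides_subset: "E \<in> sides V \<Longrightarrow> E \<subseteq> upper_half_plane"
  using geodesic_subset by (auto simp: sides_def)

lemma image_compose_sides: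
  "(`) (compose upper_half_plane f g) ` sides V = (`) f ` ((`) g ` sides V)"
proof -
  have "(`) (compose upper_half_plane f g) ` sides V = (\<lambda>E. f ` (g ` E)) ` sides V"
    by (intro image_cong refl image_compose_subset sides_subset)
  then show ?thesis
    by (simp only: image_image)
qed

definition restricted_flip :: "int \<times> int \<times> int \<Rightarrow> complex \<Rightarrow> complex" where
  "restricted_flip m = (case m of (a, b, c) \<Rightarrow> restrict (plane_flip a b c) upper_half_plane)"

lemma farey_group_eq:
  "farey_group = generate (BijGroup upper_half_plane) (restricted_flip ` basic_flips)"
proof -
  have "{restrict (plane_flip a b c) upper_half_plane | a b c. (a, b, c) \<in> basic_flips}
      = restricted_flip ` basic_flips"
    unfolding restricted_flip_def by (auto intro: rev_image_eqI)
  then show ?thesis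
    unfolding farey_group_def reflections_eq_flips by simp
qed

lemma restricted_flip_Bij:
  assumes "m \<in> basic_flips"
  shows "restricted_flip m \<in> carrier (BijGroup upper_half_plane)"
    and "inv\<^bsub>BijGroup upper_half_plane\<^esub> restricted_flip m = restricted_flip m"
proof -
  let ?H = "upper_half_plane"
  obtain a b c where m: "m = (a, b, c)"
    by (cases m)
  have det: "a * a + b * c = 1"
    using assms basic_flips_det m by blast
  have in_H: "plane_flip a b c z \<in> ?H" and inv: "plane_flip a b c (plane_flip a b c z) = z"
    if "z \<in> ?H" for z
    using that plane_flip_level(1)[OF det] plane_flip_plane_flip[OF det]
    by (auto simp: upper_half_plane_def)
  have "bij_betw (plane_flip a b c) ?H ?H"
    by (rule bij_betw_byWitness[where f' = "plane_flip a b c"]) (use in_H inv in auto)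
  then have B: "restricted_flip m \<in> Bij ?H"
    by (simp add: Bij_def restricted_flip_def m bij_betw_restrict_eq)
  then show C: "restricted_flip m \<in> carrier (BijGroup ?H)"
    by (simp add: BijGroup_def)
  have "compose ?H (restricted_flip m) (restricted_flip m) = (\<lambda>z\<in>?H. z)"
    unfolding compose_def restricted_flip_def m prod.case
    by (rule restrict_ext) (simp add: in_H inv)
  then have "restricted_flip m \<otimes>\<^bsub>BijGroup ?H\<^esub> restricted_flip m = \<one>\<^bsub>BijGroup ?H\<^esub>"
    using B by (simp add: BijGroup_def)
  then show "inv\<^bsub>BijGroup ?H\<^esub> restricted_flip m = restricted_flip m"
    by (intro group.inv_equality[OF group_BijGroup] C)
qed

lemma restricted_flip_sides:
  assumes "(a, b, c) \<in> basic_flips"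
  shows "(`) (restricted_flip (a, b, c)) ` sides V = sides (flip a b c ` V)"
proof -
  note det = basic_flips_det[OF assms]
  have g: "restricted_flip (a, b, c) ` geodesic x y = geodesic (flip a b c x) (flip a b c y)"
    if "x \<noteq> y" for x y
    unfolding restricted_flip_def prod.case image_restrict_subset[OF geodesic_subset[OF that]]
    by (rule plane_flip_geodesic[OF det that])
  have "(`) (restricted_flip (a, b, c)) ` sides V
      = {geodesic (flip a b c x) (flip a b c y) | x y. x \<in> V \<and> y \<in> V \<and> x \<noteq> y}"
    unfolding sides_def using g by (auto simp: image_iff) metis+
  also have "\<dots> = sides (flip a b c ` V)"
  proof -
    have "flip a b c x \<noteq> flip a b c y \<longleftrightarrow> x \<noteq> y" for x y
      using inj_flip[OF det] by (simp add: inj_eq)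
    then show ?thesis
      unfolding sides_def by blast
  qed
  finally show ?thesis .
qed

lemma farey_group_sides:
  assumes "g \<in> farey_group" "V \<in> farey_triangles"
  shows "\<exists>W\<in>farey_triangles. (`) g ` sides V = sides W"
proof -
  let ?H = upper_half_plane
  let ?G = "BijGroup ?H"
  have sub: "restricted_flip ` basic_flips \<subseteq> carrier ?G"
    using restricted_flip_Bij by blast
  have "g \<in> generate ?G (restricted_flip ` basic_flips)"
    using assms(1) farey_group_eq by simp
  then show ?thesis
    using assms(2)
  proof (induction arbitrary: V rule: generate.induct)
    case one
    have "\<one>\<^bsub>?G\<^esub> ` E = E" if "E \<in> sides V" for E
      unfolding BijGroup_def monoid.simps image_restrict_subset[OF sides_subset[OF that]] by simp
    then have "(`) \<one>\<^bsub>?G\<^esub> ` sides V = sides V"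
      by (auto simp: image_iff)
    then show ?case
      using one by blast
  next
    case (incl h)
    then show ?case
      using restricted_flip_sides farey_triangles.step by (metis imageE prod_cases3)
  next
    case (inv h)
    then show ?case
      using restricted_flip_sides farey_triangles.step restricted_flip_Bij(2)
      by (metis imageE prod_cases3)
  next
    case (eng h1 h2)
    obtain W where W: "W \<in> farey_triangles" "(`) h2 ` sides V = sides W"
      using eng.IH(2)[OF eng.prems] by blast
    obtain W' where W': "W' \<in> farey_triangles" "(`) h1 ` sides W = sides W'"
      using eng.IH(1)[OF W(1)] by blast
    have "h1 \<in> carrier ?G" "h2 \<in> carrier ?G"
      by (rule group.generate_in_carrier[OF group_BijGroup sub]; rule eng.hyps)+
    then have "h1 \<in> Bij ?H" "h2 \<in> Bij ?H"
      by (simp_all add: BijGroup_def)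
    then have "h1 \<otimes>\<^bsub>?G\<^esub> h2 = compose ?H h1 h2"
      by (simp add: BijGroup_def)
    then have "(`) (h1 \<otimes>\<^bsub>?G\<^esub> h2) ` sides V = (`) h1 ` ((`) h2 ` sides V)"
      by (simp only: image_compose_sides)
    then show ?case
      using W W' by auto
  qed
qed

lemma farey_triangle_in_orbit:
  assumes "V \<in> farey_triangles"
  shows "\<exists>g\<in>farey_group. (`) g ` sides basic_vertices = sides V"
  using assms
proof induction
  case base
  let ?G = "BijGroup upper_half_plane"
  have "\<one>\<^bsub>?G\<^esub> ` E = E" if "E \<in> sides basic_vertices" for E
    unfolding BijGroup_def monoid.simps image_restrict_subset[OF sides_subset[OF that]] by simp
  then have "(`) \<one>\<^bsub>?G\<^esub> ` sides basic_vertices = sides basic_vertices"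
    by (auto simp: image_iff)
  moreover have "\<one>\<^bsub>?G\<^esub> \<in> farey_group"
    unfolding farey_group_eq by (rule generate.one)
  ultimately show ?case
    by blast
next
  case (step V a b c)
  let ?H = upper_half_plane
  let ?G = "BijGroup ?H" and ?r = "restricted_flip (a, b, c)"
  obtain g where g: "g \<in> farey_group" "(`) g ` sides basic_vertices = sides V"
    using step by blast
  have sub: "restricted_flip ` basic_flips \<subseteq> carrier ?G"
    using restricted_flip_Bij by blast
  have r: "?r \<in> farey_group"
    unfolding farey_group_eq using step(2) by (intro generate.incl imageI)
  then have "?r \<otimes>\<^bsub>?G\<^esub> g \<in> farey_group"
    using g(1) unfolding farey_group_eq by (rule generate.eng)
  moreover have "g \<in> carrier ?G" "?r \<in> carrier ?G"
    by (rule group.generate_in_carrier[OF group_BijGroup sub];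
        rule g(1)[unfolded farey_group_eq] r[unfolded farey_group_eq])+
  then have "?r \<in> Bij ?H" "g \<in> Bij ?H"
    by (simp_all add: BijGroup_def)
  then have "?r \<otimes>\<^bsub>?G\<^esub> g = compose ?H ?r g"
    by (simp add: BijGroup_def)
  then have "(`) (?r \<otimes>\<^bsub>?G\<^esub> g) ` sides basic_vertices = (`) ?r ` ((`) g ` sides basic_vertices)"
    by (simp only: image_compose_sides)
  then have "(`) (?r \<otimes>\<^bsub>?G\<^esub> g) ` sides basic_vertices = sides (flip a b c ` V)"
    using g(2) restricted_flip_sides[OF step(2)] by simp
  ultimately show ?case
    by blast
qed

lemma farey_eq: "farey = edge_geodesics farey_triangles"
proof
  show "farey \<subseteq> edge_geodesics farey_triangles"
  proof
    fix F assume "F \<in> farey"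
    then obtain g E where gE: "F = g ` E" "g \<in> farey_group" "E \<in> sides basic_vertices"
      unfolding farey_def by blast
    then obtain W where "W \<in> farey_triangles" "(`) g ` sides basic_vertices = sides W"
      using farey_group_sides farey_triangles.base by blast
    then show "F \<in> edge_geodesics farey_triangles"
      unfolding edge_geodesics_def using gE by blast
  qed
  show "edge_geodesics farey_triangles \<subseteq> farey"
  proof
    fix F assume "F \<in> edge_geodesics farey_triangles"
    then obtain V where V: "V \<in> farey_triangles" "F \<in> sides V"
      unfolding edge_geodesics_def by blast
    obtain g where "g \<in> farey_group" "(`) g ` sides basic_vertices = sides V"
      using farey_triangle_in_orbit[OF V(1)] by blast
    then show "F \<in> farey"
      unfolding farey_def using V(2) by blast
  qed
qed

section \<open>Adjacency of Farey vertices\<close>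

text \<open>The points have integer coordinate vectors of determinant \<open>\<plusminus>1\<close>; such vectors are
automatically primitive, so lowest terms need not be demanded.\<close>

definition farey_adjacent :: "ideal_point \<Rightarrow> ideal_point \<Rightarrow> bool" where
  "farey_adjacent x y \<longleftrightarrow> (\<exists>(p::int) (q::int) (r::int) (s::int) (k::real) (l::real). k \<noteq> 0 \<and> l \<noteq> 0 \<and> hnum x = k * p \<and> hden x = k * q
     \<and> hnum y = l * r \<and> hden y = l * s \<and> \<bar>(p * s - r * q :: int)\<bar> = 1)"

lemma farey_adjacentI:
  fixes p q r s :: int and k l :: real
  assumes "k \<noteq> 0" "l \<noteq> 0" "hnum x = k * p" "hden x = k * q"
    "hnum y = l * r" "hden y = l * s" "\<bar>p * s - r * q\<bar> = 1"
  shows "farey_adjacent x y"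
  unfolding farey_adjacent_def
  by (rule exI[of _ p], rule exI[of _ q], rule exI[of _ r], rule exI[of _ s], rule exI[of _ k],
      rule exI[of _ l]) (use assms in simp)

lemma farey_adjacentE:
  assumes "farey_adjacent x y"
  obtains p q r s :: int and k l :: real where "k \<noteq> 0" "l \<noteq> 0" "hnum x = k * p" "hden x = k * q"
    "hnum y = l * r" "hden y = l * s" "\<bar>p * s - r * q\<bar> = 1"
  using assms unfolding farey_adjacent_def by (elim exE conjE) (rule that; assumption)

lemma farey_adjacent_sym:
  assumes "farey_adjacent x y"
  shows "farey_adjacent y x"
  by (rule farey_adjacentE[OF assms], rule farey_adjacentI) (assumption | simp add: mult.commute abs_minus_commute)+

lemma farey_adjacent_flip:
  assumes det: "a * a + b * c = 1" and xy: "farey_adjacent x y"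
  shows "farey_adjacent (flip a b c x) (flip a b c y)"
proof -
  obtain p q r s :: int and k l :: real where 1: "k \<noteq> 0" "l \<noteq> 0" "hnum x = k * p" "hden x = k * q"
    "hnum y = l * r" "hden y = l * s" "\<bar>p * s - r * q\<bar> = 1"
    by (rule farey_adjacentE[OF xy])
  obtain m where m: "m \<noteq> 0" "m * hnum (flip a b c x) = a * hnum x + b * hden x"
    "m * hden (flip a b c x) = c * hnum x - a * hden x" by (rule flip_coordinates[OF det])
  obtain n where n: "n \<noteq> 0" "n * hnum (flip a b c y) = a * hnum y + b * hden y"
    "n * hden (flip a b c y) = c * hnum y - a * hden y" by (rule flip_coordinates[OF det])
  show ?thesis
  proof (rule farey_adjacentI)
    show "k / m \<noteq> 0" "l / n \<noteq> 0"
      using 1 m n by auto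
    show "hnum (flip a b c x) = k / m * (a * p + b * q)" "hden (flip a b c x) = k / m * (c * p - a * q)"
      using m 1(3,4) by (simp_all add: field_simps)
    show "hnum (flip a b c y) = l / n * (a * r + b * s)" "hden (flip a b c y) = l / n * (c * r - a * s)"
      using n 1(5,6) by (simp_all add: field_simps)
    have "(a * p + b * q) * (c * r - a * s) - (a * r + b * s) * (c * p - a * q)
        = - (a * a + b * c) * (p * s - r * q)"
      by (simp add: algebra_simps)
    then show "\<bar>(a * p + b * q) * (c * r - a * s) - (a * r + b * s) * (c * p - a * q)\<bar> = 1"
      unfolding det using 1(7) by simp
  qed
qed

text \<open>In integer coordinates the Pluecker relation reads \<open>A - B = \<plusminus>1\<close>, where \<open>A\<close> and \<open>B\<close> are products of two
brackets each, and interleaving means \<open>A B < 0\<close>. Nonzero integers of opposite signs differ by at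
least \<open>2\<close>.\<close>

lemma farey_adjacent_not_linked:
  assumes "farey_adjacent x y" "farey_adjacent z w"
  shows "\<not> linked x y z w"
proof
  assume l: "linked x y z w"
  obtain p q r s :: int and k l :: real where 1: "k \<noteq> 0" "l \<noteq> 0" "hnum x = k * p" "hden x = k * q"
    "hnum y = l * r" "hden y = l * s" "\<bar>p * s - r * q\<bar> = 1"
    by (rule farey_adjacentE[OF assms(1)])
  obtain p' q' r' s' :: int and m n :: real where 2: "m \<noteq> 0" "n \<noteq> 0" "hnum z = m * p'" "hden z = m * q'"
    "hnum w = n * r'" "hden w = n * s'" "\<bar>p' * s' - r' * q'\<bar> = 1"
    by (rule farey_adjacentE[OF assms(2)])
  define A where "A = (p * q' - p' * q) * (r * s' - r' * s)"
  define B where "B = (p * s' - r' * q) * (r * q' - p' * s)"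
  have "A - B = (p * s - r * q) * (p' * s' - r' * q')"
    unfolding A_def B_def by (simp add: algebra_simps)
  then have d: "\<bar>A - B\<bar> = 1"
    using 1(7) 2(7) by (simp add: abs_mult)
  have "side x y z * side x y w = (k * l * m * n)\<^sup>2 * of_int (A * B)"
    unfolding side_def bracket_def 1(3-6) 2(3-6) A_def B_def
    by (simp add: power2_eq_square) algebra
  then have "of_int (A * B) < (0 :: real)"
    using l 1 2 by (simp add: linked_def mult_less_0_iff)
  then have "A * B < 0"
    by linarith
  then have "(A \<ge> 1 \<and> B \<le> -1) \<or> (A \<le> -1 \<and> B \<ge> 1)"
    by (auto simp: mult_less_0_iff)
  then show False
    using d by linarith
qed

lemma farey_adjacent_Qhat:
  assumes "farey_adjacent x y"
  shows "x \<in> Qhat"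
proof (cases x)
  case (Some t)
  obtain p q r s :: int and k l :: real where 1: "k \<noteq> 0" "l \<noteq> 0" "hnum x = k * p" "hden x = k * q"
    by (rule farey_adjacentE[OF assms]) (rule that)
  then have "k * q = 1" "t = k * p"
    using Some by simp_all
  moreover from this have "real_of_int q \<noteq> 0"
    by auto
  ultimately have "t = of_int p / of_int q"
    by (simp add: nonzero_eq_divide_eq)
  then have "t \<in> \<rat>"
    by simp
  then show ?thesis
    using Some by (simp add: Qhat_def)
qed (simp add: Qhat_def)

lemma farey_triangle_adjacent:
  assumes "V \<in> farey_triangles" "x \<in> V" "y \<in> V" "x \<noteq> y"
  shows "farey_adjacent x y"
  using assms
proof (induction arbitrary: x y)
  case base
  have "farey_adjacent (Some 0) (Some 1)"
    by (rule farey_adjacentI[of 1 1 _ 0 1 _ 1 1]) auto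
  moreover have "farey_adjacent (Some 0) None"
    by (rule farey_adjacentI[of 1 1 _ 0 1 _ 1 0]) auto
  moreover have "farey_adjacent (Some 1) None"
    by (rule farey_adjacentI[of 1 1 _ 1 1 _ 1 0]) auto
  ultimately show ?case
    using base farey_adjacent_sym by (auto simp: basic_vertices_def)
next
  case (step V a b c)
  then show ?case
    using farey_adjacent_flip[OF basic_flips_det] by blast
qed

lemma farey_triangle_card: "V \<in> farey_triangles \<Longrightarrow> card V = 3"
proof (induction rule: farey_triangles.induct)
  case (step V a b c)
  then show ?case
    using card_image inj_flip[OF basic_flips_det] by (metis inj_on_subset subset_UNIV)
qed (simp add: basic_vertices_def)

text \<open>For the basic triangle the neighbour is its mirror image in the side; flips transport this to the
whole orbit.\<close>

lemma farey_triangle_neighbour: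
  assumes "V \<in> farey_triangles" "V = {x, y, w}"
  shows "\<exists>w'. {x, y, w'} \<in> farey_triangles \<and> linked x y w w'"
  using assms
proof (induction arbitrary: x y w)
  case base
  let ?N = "\<lambda>x y w. \<exists>w'. {x, y, w'} \<in> farey_triangles \<and> linked x y w w'"
  have f: "flip (-1) 0 0 ` basic_vertices \<in> farey_triangles"
    "flip (-1) 2 0 ` basic_vertices \<in> farey_triangles"
    "flip 1 0 2 ` basic_vertices \<in> farey_triangles"
    by (rule farey_triangles.step[OF farey_triangles.base]; simp add: basic_flips_def)+
  have 1: "?N (Some 0) None (Some 1)"
    using f(1) by (intro exI[of _ "Some (-1)"])
      (simp add: basic_vertices_def linked_def side_def bracket_def insert_commute)
  have 2: "?N (Some 1) None (Some 0)"
    using f(2) by (intro exI[of _ "Some 2"])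
      (simp add: basic_vertices_def linked_def side_def bracket_def insert_commute)
  have 3: "?N (Some 0) (Some 1) None"
    using f(3) by (intro exI[of _ "Some (1 / 2)"])
      (simp add: basic_vertices_def linked_def side_def bracket_def insert_commute)
  have sym: "?N y x w" if "?N x y w" for x y w
    using that linked_swap1 by (metis insert_commute)
  have "(x, y, w) \<in> {(Some 0, Some 1, None), (Some 0, None, Some 1), (Some 1, None, Some 0),
      (Some 1, Some 0, None), (None, Some 0, Some 1), (None, Some 1, Some 0)}"
    by (rule triple_eq_cases) (use base in \<open>simp_all add: basic_vertices_def\<close>)
  then show ?case
    using 1 2 3 sym[OF 1] sym[OF 2] sym[OF 3] by (elim insertE) simp_all
next
  case (step V a b c)
  let ?f = "flip a b c"
  note det = basic_flips_det[OF step(2)]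
  have "V = ?f ` ?f ` V"
    by (simp add: image_image flip_flip[OF det])
  also have "\<dots> = {?f x, ?f y, ?f w}"
    unfolding step.prems by simp
  finally obtain w' where w': "{?f x, ?f y, w'} \<in> farey_triangles" "linked (?f x) (?f y) (?f w) w'"
    using step.IH by blast
  have "?f ` {?f x, ?f y, w'} \<in> farey_triangles"
    by (rule farey_triangles.step[OF w'(1) step(2)])
  then have "{x, y, ?f w'} \<in> farey_triangles"
    by (simp add: flip_flip[OF det])
  moreover have "linked x y w (?f w')"
    using w'(2) flip_linked[OF det, of x y w "?f w'"] by (simp add: flip_flip[OF det])
  ultimately show ?case
    by blast
qed

lemma farey_edges_adjacent: "(x, y) \<in> edges farey_triangles \<Longrightarrow> farey_adjacent x y"
  using farey_triangle_adjacent by (auto simp: edges_def)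

lemma abs_le_imp_in_ceiling_box:
  fixes i :: int and B :: real
  assumes "\<bar>real_of_int i\<bar> \<le> B"
  shows "i \<in> {- \<lceil>B\<rceil>..\<lceil>B\<rceil>}"
  using assms by (simp add: abs_le_iff) linarith

text \<open>Adjacent fractions differ by exactly \<open>1 / (q s)\<close>.\<close>

lemma farey_adjacent_real:
  assumes "farey_adjacent (Some u) (Some v)"
  obtains p q r s :: int where "q \<noteq> 0" "s \<noteq> 0" "u = p / q" "v = r / s"
    "\<bar>u - v\<bar> * (\<bar>real_of_int q\<bar> * \<bar>real_of_int s\<bar>) = 1"
proof -
  obtain p q r s :: int and k l :: real where 1: "k \<noteq> 0" "l \<noteq> 0" "u = k * p" "1 = k * q"
    "v = l * r" "1 = l * s" "\<bar>p * s - r * q\<bar> = 1"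
    using farey_adjacentE[OF assms] by (metis hden.simps(1) hnum.simps(1))
  have nz: "real_of_int q \<noteq> 0" "real_of_int s \<noteq> 0"
    using 1(4,6) by auto
  have "k = 1 / q" "l = 1 / s"
    using 1(4,6) nz by (simp_all add: nonzero_eq_divide_eq)
  then have uv: "u = p / q" "v = r / s"
    using 1(3,5) by simp_all
  have "(u - v) * (real_of_int q * real_of_int s) = of_int (p * s - r * q)"
    unfolding uv using nz by (simp add: field_simps)
  then have "\<bar>u - v\<bar> * (\<bar>real_of_int q\<bar> * \<bar>real_of_int s\<bar>) = \<bar>real_of_int (p * s - r * q)\<bar>"
    by (metis abs_mult)
  also have "\<dots> = 1"
    using 1(7) by linarith
  finally show ?thesis
    using that nz uv by simp
qed

text \<open>A lower bound on the distance of adjacent fractions bounds their denominators, and then a bound on their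
size bounds their numerators.\<close>

lemma farey_adjacent_real_finite:
  assumes "d > 0"
  shows "finite {(Some u, Some v) | u v. farey_adjacent (Some u) (Some v) \<and> \<bar>u\<bar> \<le> M \<and> \<bar>v\<bar> \<le> M
    \<and> \<bar>u - v\<bar> \<ge> d}" (is "finite ?S")
proof -
  define B where "B = max (1 / d) (M / d)"
  let ?I = "{- \<lceil>B\<rceil>..\<lceil>B\<rceil>}"
  let ?g = "\<lambda>(p, q, r, s). (Some (real_of_int p / of_int q), Some (real_of_int r / of_int s))"
  have "?S \<subseteq> ?g ` (?I \<times> ?I \<times> ?I \<times> ?I)"
  proof clarify
    fix u v assume uv: "farey_adjacent (Some u) (Some v)" "\<bar>u\<bar> \<le> M" "\<bar>v\<bar> \<le> M" "\<bar>u - v\<bar> \<ge> d"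
    obtain p q r s :: int where 1: "q \<noteq> 0" "s \<noteq> 0" "u = p / q" "v = r / s"
      "\<bar>u - v\<bar> * (\<bar>real_of_int q\<bar> * \<bar>real_of_int s\<bar>) = 1"
      by (rule farey_adjacent_real[OF uv(1)])
    have ge: "\<bar>real_of_int q\<bar> \<ge> 1" "\<bar>real_of_int s\<bar> \<ge> 1"
      using 1(1,2) by linarith+
    have "d * (\<bar>real_of_int q\<bar> * \<bar>real_of_int s\<bar>) \<le> 1"
      using mult_right_mono[OF uv(4), of "\<bar>real_of_int q\<bar> * \<bar>real_of_int s\<bar>"] 1(5) by simp
    then have prod: "\<bar>real_of_int q\<bar> * \<bar>real_of_int s\<bar> \<le> 1 / d"
      using assms by (simp add: field_simps)
    have q: "\<bar>real_of_int q\<bar> \<le> 1 / d"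
      using prod mult_left_mono[OF ge(2), of "\<bar>real_of_int q\<bar>"] by simp
    have s: "\<bar>real_of_int s\<bar> \<le> 1 / d"
      using prod mult_right_mono[OF ge(1), of "\<bar>real_of_int s\<bar>"] by simp
    have M: "M \<ge> 0"
      using uv(2) by linarith
    have "\<bar>real_of_int p\<bar> = \<bar>u\<bar> * \<bar>real_of_int q\<bar>"
      using 1(1,3) by (simp add: abs_divide)
    also have "\<dots> \<le> M * (1 / d)"
      by (rule mult_mono[OF uv(2) q M]) simp
    finally have p: "\<bar>real_of_int p\<bar> \<le> M / d"
      by simp
    have "\<bar>real_of_int r\<bar> = \<bar>v\<bar> * \<bar>real_of_int s\<bar>"
      using 1(2,4) by (simp add: abs_divide)
    also have "\<dots> \<le> M * (1 / d)"
      by (rule mult_mono[OF uv(3) s M]) simp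
    finally have r: "\<bar>real_of_int r\<bar> \<le> M / d"
      by simp
    have "p \<in> ?I" "q \<in> ?I" "r \<in> ?I" "s \<in> ?I"
      by (rule abs_le_imp_in_ceiling_box; use p q r s in \<open>simp add: B_def le_max_iff_disj\<close>)+
    then have "(p, q, r, s) \<in> ?I \<times> ?I \<times> ?I \<times> ?I"
      by blast
    moreover have "(Some u, Some v) = ?g (p, q, r, s)"
      using 1 by simp
    ultimately show "(Some u, Some v) \<in> ?g ` (?I \<times> ?I \<times> ?I \<times> ?I)"
      by (rule rev_image_eqI)
  qed
  then show ?thesis
    by (rule finite_subset) (intro finite_imageI finite_cartesian_product finite_atLeastAtMost_int)
qed

lemma farey_adjacent_infinity:
  assumes "farey_adjacent None (Some v)"
  obtains i :: int where "v = i"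
proof -
  obtain p q r s :: int and k l :: real where 1: "k \<noteq> 0" "l \<noteq> 0" "0 = k * q"
    "v = l * r" "1 = l * s" "\<bar>p * s - r * q\<bar> = 1"
    using farey_adjacentE[OF assms] by (metis hden.simps hnum.simps(1))
  then have "\<bar>p * s\<bar> = 1"
    by simp
  then have "\<bar>s\<bar> = 1"
    by (metis abs_mult abs_zmult_eq_1 mult.commute)
  then have "s = 1 \<or> s = -1"
    by linarith
  then have "l = 1 \<or> l = -1"
    using 1(5) by auto
  then show ?thesis
    using that[of r] that[of "- r"] 1(4) by auto
qed

text \<open>If \<open>x\<close> and \<open>y\<close> are real, bounded neighbourhoods at positive distance will do. If \<open>x\<close> is
\<open>\<infinity>\<close>, neighbourhoods at distance greater than \<open>1\<close> leave only edges from \<open>\<infinity>\<close> itself to integers.\<close>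

lemma farey_edges_discrete:
  assumes "x \<noteq> y"
  shows "\<exists>U W. openin Rhat U \<and> openin Rhat W \<and> x \<in> U \<and> y \<in> W
      \<and> finite (edges farey_triangles \<inter> U \<times> W)"
proof -
  let ?E = "edges farey_triangles"
  let ?D = "\<lambda>x y. \<exists>U W. openin Rhat U \<and> openin Rhat W \<and> x \<in> U \<and> y \<in> W \<and> finite (?E \<inter> U \<times> W)"
  have sym: "?D y x" if xy: "?D x y" for x y
  proof -
    obtain U W where UW: "openin Rhat U" "openin Rhat W" "x \<in> U" "y \<in> W" "finite (?E \<inter> U \<times> W)"
      using xy by blast
    have "?E \<inter> W \<times> U \<subseteq> prod.swap ` (?E \<inter> U \<times> W)"
      using edges_sym by force
    then have "finite (?E \<inter> W \<times> U)"
      using UW(5) finite_surj by blast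
    then show ?thesis
      using UW by blast
  qed
  have real: "?D (Some p) (Some q)" if "p \<noteq> q" for p q
  proof -
    define d where "d = \<bar>p - q\<bar> / 3"
    define M where "M = \<bar>p\<bar> + \<bar>q\<bar> + d"
    have d: "d > 0" and pq: "\<bar>p - q\<bar> = 3 * d"
      using that by (simp_all add: d_def)
    have "?E \<inter> Some ` {p - d<..<p + d} \<times> Some ` {q - d<..<q + d}
      \<subseteq> {(Some u, Some v) | u v. farey_adjacent (Some u) (Some v) \<and> \<bar>u\<bar> \<le> M \<and> \<bar>v\<bar> \<le> M
        \<and> \<bar>u - v\<bar> \<ge> d}"
    proof clarify
      fix u v assume e: "(Some u, Some v) \<in> ?E" and uv: "u \<in> {p - d<..<p + d}" "v \<in> {q - d<..<q + d}"
      have "\<bar>u\<bar> \<le> M" "\<bar>v\<bar> \<le> M" "\<bar>u - v\<bar> \<ge> d"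
        using pq uv unfolding M_def greaterThanLessThan_iff by linarith+
      then show "\<exists>u' v'. (Some u, Some v) = (Some u', Some v') \<and> farey_adjacent (Some u') (Some v')
          \<and> \<bar>u'\<bar> \<le> M \<and> \<bar>v'\<bar> \<le> M \<and> d \<le> \<bar>u' - v'\<bar>"
        using farey_edges_adjacent[OF e] by blast
    qed
    then have "finite (?E \<inter> Some ` {p - d<..<p + d} \<times> Some ` {q - d<..<q + d})"
      using farey_adjacent_real_finite[OF d] by (rule finite_subset)
    moreover have "openin Rhat (Some ` {p - d<..<p + d})" "openin Rhat (Some ` {q - d<..<q + d})"
      by (simp_all add: openin_Rhat_Some)
    moreover have "Some p \<in> Some ` {p - d<..<p + d}" "Some q \<in> Some ` {q - d<..<q + d}"
      using d by auto
    ultimately show ?thesis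
      by blast
  qed
  have inf: "?D None (Some q)" for q
  proof -
    define M where "M = \<bar>q\<bar> + 1"
    let ?U = "insert None (Some ` (- {- (M + 1)..M + 1}))" and ?W = "Some ` {q - 1<..<q + 1}"
    have "?E \<inter> ?U \<times> ?W \<subseteq> (\<lambda>i. (None, Some (real_of_int i))) ` {- \<lceil>M\<rceil>..\<lceil>M\<rceil>}"
    proof
      fix e assume e: "e \<in> ?E \<inter> ?U \<times> ?W"
      then obtain x v where xv: "e = (x, Some v)" "x \<in> ?U" "v \<in> {q - 1<..<q + 1}"
        by blast
      have a: "farey_adjacent x (Some v)"
        using e xv farey_edges_adjacent by blast
      have vM: "\<bar>v\<bar> \<le> M"
        using xv(3) unfolding M_def by auto
      show "e \<in> (\<lambda>i. (None, Some (real_of_int i))) ` {- \<lceil>M\<rceil>..\<lceil>M\<rceil>}"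
      proof (cases x)
        case None
        then obtain i :: int where "v = i"
          using farey_adjacent_infinity a by blast
        then show ?thesis
          using xv(1) None abs_le_imp_in_ceiling_box[of i M] vM by blast
      next
        case (Some u)
        then have "\<bar>u\<bar> > M + 1"
          using xv(2) by auto
        then have uv: "\<bar>u - v\<bar> > 1"
          using vM by linarith
        obtain p r k l :: int where 1: "k \<noteq> 0" "l \<noteq> 0"
          "\<bar>u - v\<bar> * (\<bar>real_of_int k\<bar> * \<bar>real_of_int l\<bar>) = 1"
          using farey_adjacent_real a Some by metis
        have "\<bar>real_of_int k\<bar> \<ge> 1" "\<bar>real_of_int l\<bar> \<ge> 1"
          using 1(1,2) by linarith+
        then have "\<bar>real_of_int k\<bar> * \<bar>real_of_int l\<bar> \<ge> 1"
          using mult_mono[of 1 "\<bar>real_of_int k\<bar>" 1 "\<bar>real_of_int l\<bar>"] by simp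
        then have "\<bar>u - v\<bar> * (\<bar>real_of_int k\<bar> * \<bar>real_of_int l\<bar>) > 1"
          using uv by (smt (verit) mult_le_cancel_left1)
        then show ?thesis
          using 1(3) by simp
      qed
    qed
    then have "finite (?E \<inter> ?U \<times> ?W)"
      by (rule finite_subset) simp
    moreover have "openin Rhat ?U" "openin Rhat ?W"
      by (simp_all add: openin_Rhat_Some openin_Rhat_None)
    moreover have "None \<in> ?U" "Some q \<in> ?W"
      by auto
    ultimately show ?thesis
      by blast
  qed
  show ?thesis
  proof (cases x; cases y)
    fix p q assume "x = Some p" "y = Some q"
    then show ?thesis
      using real assms by simp
  next
    fix q assume "x = None" "y = Some q"
    then show ?thesis
      using inf by simp
  next
    fix q assume "x = Some q" "y = None"
    then show ?thesis
      using sym[OF inf] by simp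
  qed (use assms in simp)
qed

lemma combinatorial_triangulation_farey: "combinatorial_triangulation farey_triangles"
proof
  show "farey_triangles \<noteq> {}"
    using farey_triangles.base by blast
  show "card V = 3" if "V \<in> farey_triangles" for V
    using that by (rule farey_triangle_card)
  show "\<not> linked x y z w" if "(x, y) \<in> edges farey_triangles" "(z, w) \<in> edges farey_triangles" for x y z w
    using that farey_edges_adjacent farey_adjacent_not_linked by blast
  show "\<exists>w'. {x, y, w'} \<in> farey_triangles \<and> linked x y w w'" if "{x, y, w} \<in> farey_triangles" for x y w
    using that farey_triangle_neighbour by blast
qed (rule farey_edges_discrete)

lemma basic_vertex_in_farey: "x \<in> basic_vertices \<Longrightarrow> x \<in> \<Union>farey_triangles"
  using farey_triangles.base by blast

lemma farey_vertex_flip: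
  assumes "x \<in> \<Union>farey_triangles" "(a, b, c) \<in> basic_flips"
  shows "flip a b c x \<in> \<Union>farey_triangles"
  using assms farey_triangles.step by blast

text \<open>A Euclidean descent, with signs disregarded: \<open>t \<mapsto> 2 - t\<close> makes the numerator of a fraction \<open>> 1\<close> smaller, and
\<open>t \<mapsto> t / (2 t - 1)\<close>, the reflection in the geodesic from \<open>0\<close> to \<open>1\<close>, makes the denominator of a fraction
between \<open>0\<close> and \<open>1\<close> smaller. The descent ends at a vertex of the basic triangle.\<close>

lemma nonneg_rational_farey_vertex:
  fixes p q :: nat
  assumes "q > 0"
  shows "Some (real p / real q) \<in> \<Union>farey_triangles"
  using assms
proof (induction "p + q" arbitrary: p q rule: less_induct)
  case less
  let ?T = "\<Union>farey_triangles"
  have neg: "Some (- x) \<in> ?T" if "Some x \<in> ?T" for x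
    using farey_vertex_flip[OF that, of "-1" 0 0] by (simp add: basic_flips_def)
  have two: "Some (2 - x) \<in> ?T" if "Some x \<in> ?T" for x
    using farey_vertex_flip[OF that, of "-1" 2 0] by (simp add: basic_flips_def)
  have inv: "Some (x / (2 * x - 1)) \<in> ?T" if "Some x \<in> ?T" "2 * x \<noteq> 1" for x
    using farey_vertex_flip[OF that(1), of 1 0 2] that(2) by (simp add: basic_flips_def)
  have base: "Some 0 \<in> ?T" "Some 1 \<in> ?T" "None \<in> ?T"
    by (rule basic_vertex_in_farey; simp add: basic_vertices_def)+
  consider "p = 0" | "p = q" | "q < p" "p \<le> 2 * q" | "2 * q < p" | "0 < p" "2 * p = q"
    | "p < q" "q < 2 * p" | "0 < p" "2 * p < q"
    by linarith
  then show ?case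
  proof cases
    case 1
    then show ?thesis
      using base by simp
  next
    case 2
    then show ?thesis
      using base less.prems by simp
  next
    case 3
    then have "Some (real (2 * q - p) / real q) \<in> ?T"
      using less by (intro less.hyps) auto
    moreover have "2 - real (2 * q - p) / real q = real p / real q"
      using 3 less.prems by (simp add: of_nat_diff field_simps)
    ultimately show ?thesis
      using two by metis
  next
    case 4
    then have "Some (real (p - 2 * q) / real q) \<in> ?T"
      using less by (intro less.hyps) auto
    moreover have "2 - - (real (p - 2 * q) / real q) = real p / real q"
      using 4 less.prems by (simp add: of_nat_diff field_simps)
    ultimately show ?thesis
      using two neg by metis
  next
    case 5
    then have "real p / real q = 1 / 2"
      by (auto simp: field_simps)
    then show ?thesis
      using farey_vertex_flip[OF base(3), of 1 0 2] by (simp add: basic_flips_def)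
  next
    case 6
    let ?y = "real p / real (2 * p - q)"
    have "Some ?y \<in> ?T"
      using less 6 by (intro less.hyps) auto
    moreover have "2 * ?y \<noteq> 1" "?y / (2 * ?y - 1) = real p / real q"
      using 6 less.prems by (simp_all add: of_nat_diff field_simps)
    ultimately show ?thesis
      using inv by metis
  next
    case 7
    let ?y = "- (real p / real (q - 2 * p))"
    have "Some (real p / real (q - 2 * p)) \<in> ?T"
      using less 7 by (intro less.hyps) auto
    then have "Some ?y \<in> ?T"
      by (rule neg)
    moreover have "2 * ?y \<noteq> 1" "?y / (2 * ?y - 1) = real p / real q"
      using 7 less.prems by (simp_all add: of_nat_diff field_simps)
    ultimately show ?thesis
      using inv by metis
  qed
qed

lemma farey_vertices: "\<Union>farey_triangles = Qhat"
proof
  show "\<Union>farey_triangles \<subseteq> Qhat"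
  proof
    fix x assume "x \<in> \<Union>farey_triangles"
    then obtain V where V: "V \<in> farey_triangles" "x \<in> V"
      by blast
    then have "V \<noteq> {x}"
      using farey_triangle_card by force
    then obtain y where "y \<in> V" "y \<noteq> x"
      using V by blast
    then show "x \<in> Qhat"
      using farey_triangle_adjacent[OF V, of y] farey_adjacent_Qhat by blast
  qed
  show "Qhat \<subseteq> \<Union>farey_triangles"
  proof
    fix x assume x: "x \<in> Qhat"
    show "x \<in> \<Union>farey_triangles"
    proof (cases x)
      case None
      then show ?thesis
        using basic_vertex_in_farey[of None] by (simp add: basic_vertices_def)
    next
      case (Some t)
      then have "t \<in> \<rat>"
        using x by (auto simp: Qhat_def)
      then obtain m n :: nat where mn: "n \<noteq> 0" "\<bar>t\<bar> = real m / real n"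
        by (rule Rats_abs_nat_div_natE)
      then have abs: "Some \<bar>t\<bar> \<in> \<Union>farey_triangles"
        using nonneg_rational_farey_vertex[of n m] by simp
      have "Some (- \<bar>t\<bar>) \<in> \<Union>farey_triangles"
        using farey_vertex_flip[OF abs, of "-1" 0 0] by (simp add: basic_flips_def)
      then show ?thesis
        using abs Some by (cases "t \<ge> 0") auto
    qed
  qed
qed

section \<open>Homeomorphic images of combinatorial triangulations\<close>

lemma edges_image:
  assumes "inj h"
  shows "edges ((`) h ` VV) = map_prod h h ` edges VV"
proof
  show "edges ((`) h ` VV) \<subseteq> map_prod h h ` edges VV"
  proof clarify
    fix a b assume "(a, b) \<in> edges ((`) h ` VV)"
    then obtain V x y where V: "V \<in> VV" "x \<in> V" "y \<in> V" "a = h x" "b = h y" "a \<noteq> b"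
      unfolding edges_def by blast
    then have "(x, y) \<in> edges VV"
      by (intro edgesI) auto
    then show "(a, b) \<in> map_prod h h ` edges VV"
      using V by (intro rev_image_eqI) auto
  qed
  show "map_prod h h ` edges VV \<subseteq> edges ((`) h ` VV)"
  proof
    fix e assume "e \<in> map_prod h h ` edges VV"
    then obtain V x y where V: "V \<in> VV" "x \<in> V" "y \<in> V" "x \<noteq> y" "e = (h x, h y)"
      unfolding edges_def by auto
    then have "h x \<noteq> h y"
      using assms by (simp add: inj_eq)
    then show "e \<in> edges ((`) h ` VV)"
      unfolding V(5) by (intro edgesI[of "h ` V"] imageI V(1-3))
  qed
qed

lemma image_triangulation_edge_geodesics:
  assumes "inj h"
  shows "image_triangulation h (edge_geodesics VV) = edge_geodesics ((`) h ` VV)"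
proof -
  have "x \<noteq> y \<and> geodesic x y \<in> edge_geodesics VV \<longleftrightarrow> (x, y) \<in> edges VV" for x y
    using geodesic_in_edge_geodesics_iff[of x y VV] by (cases "x = y") (simp_all add: edges_def)
  then have "image_triangulation h (edge_geodesics VV) = {geodesic (h x) (h y) | x y. (x, y) \<in> edges VV}"
    unfolding image_triangulation_def by simp
  also have "\<dots> = edge_geodesics ((`) h ` VV)"
    unfolding edge_geodesics_eq edges_image[OF assms] by auto
  finally show ?thesis .
qed

text \<open>Interleaving is preserved by homeomorphisms, and the other conditions are set-theoretic or topological.\<close>

lemma combinatorial_triangulation_image:
  assumes h: "homeomorphic_map Rhat Rhat h" and VV: "combinatorial_triangulation VV"
  shows "combinatorial_triangulation ((`) h ` VV)"
proof -
  interpret combinatorial_triangulation VV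
    by (rule VV)
  have bij: "bij h"
    using homeomorphism_inverse[OF h] by blast
  then have inj: "inj h"
    by (rule bij_is_inj)
  note E = edges_image[OF inj, of VV]
  show ?thesis
  proof
    show "(`) h ` VV \<noteq> {}"
      using nonempty by simp
    show "card V = 3" if V: "V \<in> (`) h ` VV" for V
    proof -
      obtain W where "W \<in> VV" "V = h ` W"
        using V by blast
      then show ?thesis
        using card3[of W] card_image[OF inj_on_subset[OF inj subset_UNIV], of W] by simp
    qed
    show "\<not> linked x y z w" if e: "(x, y) \<in> edges ((`) h ` VV)" "(z, w) \<in> edges ((`) h ` VV)" for x y z w
      using e not_linked homeomorphism_linked_iff[OF h] unfolding E by auto
    show "\<exists>w'. {x, y, w'} \<in> (`) h ` VV \<and> linked x y w w'" if xyw: "{x, y, w} \<in> (`) h ` VV" for x y w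
    proof -
      obtain W where W: "W \<in> VV" "{x, y, w} = h ` W"
        using xyw by blast
      obtain x' y' w' where 1: "x = h x'" "y = h y'" "w = h w'"
        using bij by (metis bij_pointE)
      then have "h ` W = h ` {x', y', w'}"
        using W(2) by simp
      then have "{x', y', w'} \<in> VV"
        using W(1) inj by (metis inj_image_eq_iff)
      then obtain v where v: "{x', y', v} \<in> VV" "linked x' y' w' v"
        using neighbour by blast
      then have "linked x y w (h v)"
        using homeomorphism_linked_iff[OF h] 1 by simp
      moreover have "{x, y, h v} \<in> (`) h ` VV"
        using v(1) 1 by (intro rev_image_eqI[OF v(1)]) simp
      ultimately show ?thesis
        by blast
    qed
    show "\<exists>U W. openin Rhat U \<and> openin Rhat W \<and> x \<in> U \<and> y \<in> W \<and> finite (edges ((`) h ` VV) \<inter> U \<times> W)"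
      if "x \<noteq> y" for x y
    proof -
      obtain x' y' where xy: "x = h x'" "y = h y'"
        using bij by (metis bij_pointE)
      then have "x' \<noteq> y'"
        using that by blast
      from discrete[OF this] obtain U W where UW: "openin Rhat U" "openin Rhat W" "x' \<in> U" "y' \<in> W"
        "finite (edges VV \<inter> U \<times> W)"
        by blast
      have "openin Rhat (h ` U)" "openin Rhat (h ` W)"
        using UW h homeomorphic_map_openness_eq by blast+
      moreover have "edges ((`) h ` VV) \<inter> h ` U \<times> h ` W \<subseteq> map_prod h h ` (edges VV \<inter> U \<times> W)"
        unfolding E using inj by (auto simp: inj_eq)
      then have "finite (edges ((`) h ` VV) \<inter> h ` U \<times> h ` W)"
        using UW(5) finite_surj by blast
      moreover have "x \<in> h ` U" "y \<in> h ` W"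
        using xy UW by auto
      ultimately show ?thesis
        by blast
    qed
  qed
qed

section \<open>Intersection numbers\<close>

definition crossing_edges ::
  "(ideal_point \<times> ideal_point) \<Rightarrow> (ideal_point \<times> ideal_point) set \<Rightarrow> (ideal_point \<times> ideal_point) set" where
  "crossing_edges e E = {f \<in> E. linked (fst e) (snd e) (fst f) (snd f)}"

definition crossings_bounded ::
  "(ideal_point \<times> ideal_point) set \<Rightarrow> (ideal_point \<times> ideal_point) set \<Rightarrow> bool" where
  "crossings_bounded E F \<longleftrightarrow>
     (\<exists>n. \<forall>e\<in>E. finite (crossing_edges e F) \<and> card (crossing_edges e F) \<le> n)"

context combinatorial_triangulation
begin

lemma intersection_points_eq:
  assumes "x \<noteq> y"
  shows "{z \<in> geodesic x y. \<exists>E\<in>edge_geodesics VV. E \<noteq> geodesic x y \<and> z \<in> E}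
    = (\<Union>(a, b)\<in>crossing_edges (x, y) (edges VV). geodesic x y \<inter> geodesic a b)" (is "?P = ?Q")
proof
  show "?P \<subseteq> ?Q"
  proof
    fix z assume "z \<in> ?P"
    then obtain E where z: "z \<in> geodesic x y" "z \<in> E"
      and E: "E \<in> edge_geodesics VV" "E \<noteq> geodesic x y"
      by blast
    then obtain a b where ab: "(a, b) \<in> edges VV" "E = geodesic a b"
      unfolding edge_geodesics_eq by blast
    then have "a \<noteq> b"
      by (simp add: edges_def)
    then have "linked x y a b"
      using geodesics_meet_imp[OF assms, of a b z] z E ab geodesic_eq_iff[OF assms] by blast
    then show "z \<in> ?Q"
      using z ab by (auto simp: crossing_edges_def)
  qed
  show "?Q \<subseteq> ?P"
  proof
    fix z assume "z \<in> ?Q"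
    then obtain a b where ab: "(a, b) \<in> crossing_edges (x, y) (edges VV)"
      and z: "z \<in> geodesic x y" "z \<in> geodesic a b"
      by blast
    then have l: "linked x y a b" and e: "(a, b) \<in> edges VV"
      by (auto simp: crossing_edges_def)
    have "geodesic a b \<noteq> geodesic x y"
      using geodesic_eq_iff[of a b x y] linked_distinct[OF l] by (auto simp: doubleton_eq_iff)
    moreover have "geodesic a b \<in> edge_geodesics VV"
      using e unfolding edge_geodesics_eq by blast
    ultimately show "z \<in> ?P"
      using z by blast
  qed
qed

text \<open>Different edges have no common point, so only the two orientations of one edge can occur.\<close>

lemma edges_through_point:
  "finite {(a, b) \<in> edges VV. z \<in> geodesic a b} \<and> card {(a, b) \<in> edges VV. z \<in> geodesic a b} \<le> 2"
proof (cases "{(a, b) \<in> edges VV. z \<in> geodesic a b} = {}")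
  case False
  then obtain a b where ab: "(a, b) \<in> edges VV" "z \<in> geodesic a b"
    by blast
  have "{(a, b) \<in> edges VV. z \<in> geodesic a b} \<subseteq> {(a, b), (b, a)}"
  proof
    fix e assume "e \<in> {(a, b) \<in> edges VV. z \<in> geodesic a b}"
    then obtain c d where cd: "e = (c, d)" "(c, d) \<in> edges VV" "z \<in> geodesic c d"
      by blast
    have "a \<noteq> b" "c \<noteq> d"
      using ab(1) cd(2) by (simp_all add: edges_def)
    then have "{a, b} = {c, d}"
      using geodesics_meet_imp[OF _ _ ab(2) cd(3)] not_linked[OF ab(1) cd(2)] by blast
    then show "e \<in> {(a, b), (b, a)}"
      using cd(1) by (auto simp: doubleton_eq_iff)
  qed
  moreover have "card {(a, b), (b, a)} \<le> 2"
    by (rule card_insert_le_m1) simp_all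
  ultimately show ?thesis
    by (meson card_mono finite.emptyI finite.insertI finite_subset order_trans)
next
  case True
  show ?thesis
    unfolding True by simp
qed

text \<open>Each crossing edge contributes one intersection point, and at most two oriented edges contribute the
same one. Hence the number of points and the number of crossing edges bound each other.\<close>

lemma intersection_number_crossing_edges:
  assumes "x \<noteq> y"
  shows "finite (crossing_edges (x, y) (edges VV)) \<Longrightarrow>
      intersection_number (geodesic x y) (edge_geodesics VV) \<le> enat (card (crossing_edges (x, y) (edges VV)))"
    and "intersection_number (geodesic x y) (edge_geodesics VV) \<le> enat n \<Longrightarrow>
      finite (crossing_edges (x, y) (edges VV)) \<and> card (crossing_edges (x, y) (edges VV)) \<le> n * 2"
proof -
  define P where "P = {z \<in> geodesic x y. \<exists>E\<in>edge_geodesics VV. E \<noteq> geodesic x y \<and> z \<in> E}"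
  define C where "C = crossing_edges (x, y) (edges VV)"
  have PC: "P = (\<Union>(a, b)\<in>C. geodesic x y \<inter> geodesic a b)"
    unfolding P_def C_def by (rule intersection_points_eq[OF assms])
  have i: "intersection_number (geodesic x y) (edge_geodesics VV) = (if finite P then enat (card P) else \<infinity>)"
    unfolding intersection_number_def P_def Let_def by simp
  have one: "finite (geodesic x y \<inter> geodesic a b) \<and> card (geodesic x y \<inter> geodesic a b) \<le> 1"
    "geodesic x y \<inter> geodesic a b \<noteq> {}" if ab: "(a, b) \<in> C" for a b
  proof -
    have l: "linked x y a b"
      using ab by (simp add: C_def crossing_edges_def)
    show "geodesic x y \<inter> geodesic a b \<noteq> {}"
      by (rule geodesics_meet_if_linked[OF l])
    then obtain p where "p \<in> geodesic x y \<inter> geodesic a b"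
      by blast
    then have "geodesic x y \<inter> geodesic a b = {p}"
      using linked_geodesics_meet_once[OF l] by blast
    then show "finite (geodesic x y \<inter> geodesic a b) \<and> card (geodesic x y \<inter> geodesic a b) \<le> 1"
      by simp
  qed
  show "intersection_number (geodesic x y) (edge_geodesics VV) \<le> enat (card (crossing_edges (x, y) (edges VV)))"
    if "finite (crossing_edges (x, y) (edges VV))"
  proof -
    have C: "finite C"
      using that by (simp add: C_def)
    have "finite P"
      unfolding PC using C one by auto
    moreover have "card P \<le> (\<Sum>(a, b)\<in>C. card (geodesic x y \<inter> geodesic a b))"
      using card_UN_le[OF C, of "\<lambda>(a, b). geodesic x y \<inter> geodesic a b"]
      by (simp only: PC case_prod_unfold)
    moreover have "(\<Sum>(a, b)\<in>C. card (geodesic x y \<inter> geodesic a b)) \<le> (\<Sum>e\<in>C. 1)"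
      by (rule sum_mono) (use one in auto)
    ultimately show ?thesis
      unfolding i C_def[symmetric] by simp
  qed
  show "finite (crossing_edges (x, y) (edges VV)) \<and> card (crossing_edges (x, y) (edges VV)) \<le> n * 2"
    if "intersection_number (geodesic x y) (edge_geodesics VV) \<le> enat n"
  proof -
    have P: "finite P" "card P \<le> n"
      using that unfolding i by (auto split: if_splits)
    let ?F = "\<lambda>z. {(a, b) \<in> edges VV. z \<in> geodesic a b}"
    have sub: "C \<subseteq> (\<Union>z\<in>P. ?F z)"
    proof clarify
      fix a b assume ab: "(a, b) \<in> C"
      obtain z where z: "z \<in> geodesic x y \<inter> geodesic a b"
        using one(2)[OF ab] by blast
      then have "z \<in> P"
        unfolding PC using ab by blast
      moreover have "(a, b) \<in> ?F z"
        using ab z by (simp add: C_def crossing_edges_def)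
      ultimately show "(a, b) \<in> (\<Union>z\<in>P. ?F z)"
        by blast
    qed
    have fin: "finite (\<Union>z\<in>P. ?F z)"
      using P(1) edges_through_point by (intro finite_UN_I) auto
    have "card C \<le> card (\<Union>z\<in>P. ?F z)"
      by (rule card_mono[OF fin sub])
    also have "\<dots> \<le> (\<Sum>z\<in>P. card (?F z))"
      by (rule card_UN_le[OF P(1)])
    also have "\<dots> \<le> (\<Sum>z\<in>P. 2)"
      by (rule sum_mono) (use edges_through_point in blast)
    also have "\<dots> \<le> n * 2"
      using P(2) by simp
    finally show ?thesis
      using finite_subset[OF sub fin] unfolding C_def by simp
  qed
qed

end

lemma Sup_intersection_number_finite_iff:
  assumes "combinatorial_triangulation WW"
  shows "(SUP \<alpha>\<in>edge_geodesics VV. intersection_number \<alpha> (edge_geodesics WW)) < \<infinity>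
    \<longleftrightarrow> crossings_bounded (edges VV) (edges WW)"
proof -
  interpret combinatorial_triangulation WW
    by (rule assms)
  let ?i = "\<lambda>\<alpha>. intersection_number \<alpha> (edge_geodesics WW)"
  show ?thesis
  proof
    assume "(SUP \<alpha>\<in>edge_geodesics VV. ?i \<alpha>) < \<infinity>"
    then obtain n where n: "(SUP \<alpha>\<in>edge_geodesics VV. ?i \<alpha>) = enat n"
      by (cases "SUP \<alpha>\<in>edge_geodesics VV. ?i \<alpha>") auto
    have "finite (crossing_edges e (edges WW)) \<and> card (crossing_edges e (edges WW)) \<le> n * 2"
      if "e \<in> edges VV" for e
    proof -
      obtain x y where e: "e = (x, y)"
        by (cases e)
      then have "x \<noteq> y" "geodesic x y \<in> edge_geodesics VV"
        using that edge_geodesics_eq by (auto simp: edges_def)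
      then have "?i (geodesic x y) \<le> enat n"
        unfolding n[symmetric] by (intro SUP_upper)
      then show ?thesis
        using intersection_number_crossing_edges(2)[OF \<open>x \<noteq> y\<close>] e by simp
    qed
    then show "crossings_bounded (edges VV) (edges WW)"
      unfolding crossings_bounded_def by blast
  next
    assume "crossings_bounded (edges VV) (edges WW)"
    then obtain n where n: "\<And>e. e \<in> edges VV \<Longrightarrow>
        finite (crossing_edges e (edges WW)) \<and> card (crossing_edges e (edges WW)) \<le> n"
      unfolding crossings_bounded_def by blast
    have "?i \<alpha> \<le> enat n" if \<alpha>: "\<alpha> \<in> edge_geodesics VV" for \<alpha>
    proof -
      obtain x y where e: "(x, y) \<in> edges VV" "\<alpha> = geodesic x y"
        using \<alpha> unfolding edge_geodesics_eq by blast
      then have "x \<noteq> y"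
        by (simp add: edges_def)
      then have "?i \<alpha> \<le> enat (card (crossing_edges (x, y) (edges WW)))"
        using intersection_number_crossing_edges(1) n[OF e(1)] e(2) by blast
      also have "\<dots> \<le> enat n"
        using n[OF e(1)] by simp
      finally show ?thesis .
    qed
    then have "(SUP \<alpha>\<in>edge_geodesics VV. ?i \<alpha>) \<le> enat n"
      by (rule SUP_least)
    also have "\<dots> < \<infinity>"
      by simp
    finally show "(SUP \<alpha>\<in>edge_geodesics VV. ?i \<alpha>) < \<infinity>" .
  qed
qed

lemma crossings_bounded_image:
  assumes h: "homeomorphic_map Rhat Rhat h" and "crossings_bounded E F"
  shows "crossings_bounded (map_prod h h ` E) (map_prod h h ` F)"
proof -
  obtain n where n: "\<And>e. e \<in> E \<Longrightarrow> finite (crossing_edges e F) \<and> card (crossing_edges e F) \<le> n"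
    using assms(2) unfolding crossings_bounded_def by blast
  have "finite (crossing_edges e (map_prod h h ` F)) \<and> card (crossing_edges e (map_prod h h ` F)) \<le> n"
    if e: "e \<in> map_prod h h ` E" for e
  proof -
    obtain e' where e': "e' \<in> E" "e = map_prod h h e'"
      by (rule imageE[OF e]) (rule that)
    have "crossing_edges e (map_prod h h ` F) = map_prod h h ` crossing_edges e' F"
      unfolding crossing_edges_def e'(2) Compr_image_eq
      by (simp add: homeomorphism_linked_iff[OF h])
    then show ?thesis
      using n[OF e'(1)] card_image_le[of "crossing_edges e' F" "map_prod h h"] by simp
  qed
  then show ?thesis
    unfolding crossings_bounded_def by blast
qed

lemma card_UN_bounded:
  fixes n :: nat
  assumes "finite A" "\<And>a. a \<in> A \<Longrightarrow> finite (f a) \<and> card (f a) \<le> n"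
  shows "finite (\<Union>a\<in>A. f a)" "card (\<Union>a\<in>A. f a) \<le> card A * n"
proof -
  show "finite (\<Union>a\<in>A. f a)"
    using assms by blast
  have "card (\<Union>a\<in>A. f a) \<le> (\<Sum>a\<in>A. card (f a))"
    by (rule card_UN_le[OF assms(1)])
  also have "\<dots> \<le> (\<Sum>a\<in>A. n)"
    by (rule sum_mono) (use assms(2) in blast)
  finally show "card (\<Union>a\<in>A. f a) \<le> card A * n"
    by simp
qed

text \<open>If \<open>e\<close> is not itself an edge of \<open>VV\<close>, a geodesic of \<open>F\<close> that crosses \<open>e\<close> does so in a triangle of \<open>VV\<close> that has a side crossing
\<open>e\<close>. There are boundedly many such triangles, and the geodesic is a side of one of them or crosses such
a side.\<close>

lemma crossings_bounded_trans:
  assumes VV: "combinatorial_triangulation VV"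
    and E: "\<And>x y. (x, y) \<in> E \<Longrightarrow> x \<noteq> y" and F: "\<And>x y. (x, y) \<in> F \<Longrightarrow> x \<noteq> y"
    and EV: "crossings_bounded E (edges VV)" and VF: "crossings_bounded (edges VV) F"
  shows "crossings_bounded E F"
proof -
  interpret combinatorial_triangulation VV
    by (rule VV)
  obtain n where n: "\<And>e. e \<in> E \<Longrightarrow>
      finite (crossing_edges e (edges VV)) \<and> card (crossing_edges e (edges VV)) \<le> n"
    using EV unfolding crossings_bounded_def by blast
  obtain m where m: "\<And>e. e \<in> edges VV \<Longrightarrow> finite (crossing_edges e F) \<and> card (crossing_edges e F) \<le> m"
    using VF unfolding crossings_bounded_def by blast
  \<comment> \<open>At most \<open>2 n\<close> triangles, each with at most \<open>9\<close> pairs of vertices \<open>f\<close>; for each, \<open>f\<close> itself and the \<open>m\<close> edges crossing it. The first summand serves edges that are common to both triangulations.\<close>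
  define N where "N = m + n * 2 * 9 * (m + 1)"
  have "finite (crossing_edges e F) \<and> card (crossing_edges e F) \<le> N" if e: "e \<in> E" for e
  proof (cases "e \<in> edges VV")
    case True
    then show ?thesis
      using m by (fastforce simp: N_def)
  next
    case False
    obtain x y where xy: "e = (x, y)" "x \<noteq> y"
      using E e by (cases e) auto
    define C where "C = crossing_edges e (edges VV)"
    define D where "D = (\<Union>f\<in>C. {V \<in> VV. fst f \<in> V \<and> snd f \<in> V})"
    define A where "A = (\<Union>V\<in>D. {f \<in> V \<times> V. fst f \<noteq> snd f})"
    have C: "finite C" "card C \<le> n"
      using n[OF e] by (simp_all add: C_def)
    have "finite {V \<in> VV. fst f \<in> V \<and> snd f \<in> V} \<and> card {V \<in> VV. fst f \<in> V \<and> snd f \<in> V} \<le> 2"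
      if "f \<in> C" for f
    proof -
      have "fst f \<noteq> snd f"
        using that by (auto simp: C_def crossing_edges_def edges_def)
      then show ?thesis
        using triangles_on_edge by blast
    qed
    note D0 = card_UN_bounded[where f = "\<lambda>f. {V \<in> VV. fst f \<in> V \<and> snd f \<in> V}", OF C(1) this]
    have D: "finite D" "card D \<le> n * 2" "D \<subseteq> VV"
      using D0 C(2) mult_le_mono1[OF C(2), of 2] unfolding D_def by auto
    have "finite {f \<in> V \<times> V. fst f \<noteq> snd f} \<and> card {f \<in> V \<times> V. fst f \<noteq> snd f} \<le> 9" if "V \<in> D" for V
    proof -
      have c: "card V = 3"
        using that D(3) card3 by blast
      then have fin: "finite (V \<times> V)"
        by (simp add: card_ge_0_finite)
      have "card {f \<in> V \<times> V. fst f \<noteq> snd f} \<le> card (V \<times> V)"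
        by (rule card_mono[OF fin]) blast
      then show ?thesis
        using c fin by (simp add: card_cartesian_product)
    qed
    note A0 = card_UN_bounded[where f = "\<lambda>V. {f \<in> V \<times> V. fst f \<noteq> snd f}", OF D(1) this]
    have A: "finite A" "card A \<le> n * 2 * 9" "A \<subseteq> edges VV"
      using A0 mult_le_mono1[OF D(2), of 9] D(3) unfolding A_def by (auto intro: edgesI)
    have "finite (insert f (crossing_edges f F)) \<and> card (insert f (crossing_edges f F)) \<le> m + 1"
      if "f \<in> A" for f
      using m[of f] A(3) that card_insert_le_m1[of "m + 1" "crossing_edges f F" f] by auto
    note U0 = card_UN_bounded[where f = "\<lambda>f. insert f (crossing_edges f F)", OF A(1) this]
    have sub: "crossing_edges e F \<subseteq> (\<Union>f\<in>A. insert f (crossing_edges f F))"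
    proof clarify
      fix z w assume zw: "(z, w) \<in> crossing_edges e F"
      then have l: "linked x y z w" and zwF: "(z, w) \<in> F"
        by (simp_all add: crossing_edges_def xy)
      have "z \<noteq> w"
        using F zwF by blast
      obtain p where p: "p \<in> geodesic x y" "p \<in> geodesic z w"
        using geodesics_meet_if_linked[OF l] by blast
      then have "Im p > 0"
        using xy(2) by (simp add: geodesic_iff)
      then obtain V where V: "V \<in> VV" "p \<in> ideal_triangle V"
        using covers by blast
      have "\<not> {x, y} \<subseteq> V"
        using False xy V(1) edgesI by blast
      then obtain a b where ab: "a \<in> V" "b \<in> V" "linked x y a b"
        using geodesic_through_triangle[OF card3[OF V(1)] V(2) p(1) xy(2)] by blast
      then have "(a, b) \<in> edges VV"
        using V(1) linked_distinct(5)[OF ab(3)] edgesI by blast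
      then have "(a, b) \<in> C"
        using ab(3) by (simp add: C_def crossing_edges_def xy)
      then have "V \<in> D"
        unfolding D_def using V(1) ab(1,2) by force
      then have in_A: "(c, d) \<in> A" if "c \<in> V" "d \<in> V" "c \<noteq> d" for c d
        unfolding A_def using that by force
      consider "{z, w} \<subseteq> V" | c d where "c \<in> V" "d \<in> V" "linked z w c d"
        using geodesic_through_triangle[OF card3[OF V(1)] V(2) p(2) \<open>z \<noteq> w\<close>] by blast
      then show "(z, w) \<in> (\<Union>f\<in>A. insert f (crossing_edges f F))"
      proof cases
        case 1
        then show ?thesis
          using in_A[of z w] \<open>z \<noteq> w\<close> by blast
      next
        case 2
        have "(z, w) \<in> crossing_edges (c, d) F"
          using zwF linked_commute[of z w c d] 2(3) by (simp add: crossing_edges_def)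
        then show ?thesis
          using in_A[OF 2(1,2) linked_distinct(5)[OF 2(3)]] by blast
      qed
    qed
    have "card (crossing_edges e F) \<le> card (\<Union>f\<in>A. insert f (crossing_edges f F))"
      by (rule card_mono[OF U0(1) sub])
    also have "\<dots> \<le> card A * (m + 1)"
      by (rule U0(2))
    also have "\<dots> \<le> n * 2 * 9 * (m + 1)"
      using A(2) by (rule mult_le_mono1)
    finally show ?thesis
      using finite_subset[OF sub U0(1)] by (simp add: N_def)
  qed
  then show ?thesis
    unfolding crossings_bounded_def by blast
qed

section \<open>The group\<close>

abbreviation farey_edges :: "(ideal_point \<times> ideal_point) set" where
  "farey_edges \<equiv> edges farey_triangles"

text \<open>Allowability of both triangulations is automatic, and the two suprema of intersection numbers are finite
exactly when the numbers of crossing edges are bounded.\<close>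

lemma MH_iff:
  "h \<in> MH \<longleftrightarrow> homeomorphic_map Rhat Rhat h \<and> h ` Qhat = Qhat
    \<and> crossings_bounded farey_edges (map_prod h h ` farey_edges)
    \<and> crossings_bounded (map_prod h h ` farey_edges) farey_edges"
proof (cases "homeomorphic_map Rhat Rhat h \<and> h ` Qhat = Qhat")
  case True
  then have inj: "inj h"
    using homeomorphism_inverse(1) bij_is_inj by blast
  note F = combinatorial_triangulation_farey
  have H: "combinatorial_triangulation ((`) h ` farey_triangles)"
    using combinatorial_triangulation_image F True by blast
  have "\<Union>((`) h ` farey_triangles) = Qhat"
    using True farey_vertices by (metis image_Union)
  then have "allowable (edge_geodesics farey_triangles)"
    "allowable (edge_geodesics ((`) h ` farey_triangles))"
    using combinatorial_triangulation.allowable F H farey_vertices by blast+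
  then show ?thesis
    using True unfolding MH_def mem_Collect_eq finite_intersection_property_def farey_eq
      image_triangulation_edge_geodesics[OF inj] Sup_intersection_number_finite_iff[OF F]
      Sup_intersection_number_finite_iff[OF H] edges_image[OF inj]
    by simp
qed (auto simp: MH_def)

lemma farey_edge_images_distinct:
  assumes "inj h" "(x, y) \<in> map_prod h h ` farey_edges"
  shows "x \<noteq> y"
  using assms by (auto simp: edges_def inj_eq)

lemma id_in_MH: "id \<in> MH"
proof -
  have "crossing_edges e farey_edges = {}" if "e \<in> farey_edges" for e
    using that combinatorial_triangulation.not_linked[OF combinatorial_triangulation_farey]
    by (cases e) (auto simp: crossing_edges_def)
  then have "crossings_bounded farey_edges farey_edges"
    by (simp add: crossings_bounded_def)
  moreover have "homeomorphic_map Rhat Rhat id"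
    by (simp add: homeomorphic_map_id)
  ultimately show ?thesis
    by (simp add: MH_iff map_prod.id)
qed

text \<open>The triangulation \<open>h(F)\<close> is the intermediate one: it is comparable with \<open>F\<close> because \<open>h\<close> is in
\<open>MH\<close>, and with \<open>h(g(F))\<close> because \<open>F\<close> is comparable with \<open>g(F)\<close>.\<close>

lemma comp_in_MH:
  assumes "h \<in> MH" "g \<in> MH"
  shows "h \<circ> g \<in> MH"
proof -
  let ?F = farey_edges
  let ?h = "map_prod h h" and ?g = "map_prod g g"
  have h: "homeomorphic_map Rhat Rhat h" "h ` Qhat = Qhat"
    "crossings_bounded ?F (?h ` ?F)" "crossings_bounded (?h ` ?F) ?F"
    using assms(1) by (simp_all add: MH_iff)
  have g: "homeomorphic_map Rhat Rhat g" "g ` Qhat = Qhat"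
    "crossings_bounded ?F (?g ` ?F)" "crossings_bounded (?g ` ?F) ?F"
    using assms(2) by (simp_all add: MH_iff)
  have hg: "homeomorphic_map Rhat Rhat (h \<circ> g)"
    using g(1) h(1) by (rule homeomorphic_map_compose)
  have inj: "inj h" "inj (h \<circ> g)"
    using homeomorphism_inverse(1) h(1) hg bij_is_inj by blast+
  have img: "map_prod (h \<circ> g) (h \<circ> g) ` ?F = ?h ` ?g ` ?F"
    by (simp add: map_prod.comp[symmetric] image_comp)
  have T: "combinatorial_triangulation ((`) h ` farey_triangles)"
    using combinatorial_triangulation_image h(1) combinatorial_triangulation_farey by blast
  have e: "edges ((`) h ` farey_triangles) = ?h ` ?F"
    by (rule edges_image[OF inj(1)])
  have 1: "crossings_bounded (?h ` ?F) (?h ` ?g ` ?F)"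
    by (rule crossings_bounded_image[OF h(1) g(3)])
  have 2: "crossings_bounded (?h ` ?g ` ?F) (?h ` ?F)"
    by (rule crossings_bounded_image[OF h(1) g(4)])
  have d1: "x \<noteq> y" if "(x, y) \<in> ?F" for x y
    using that by (simp add: edges_def)
  have d2: "x \<noteq> y" if "(x, y) \<in> ?h ` ?g ` ?F" for x y
    using farey_edge_images_distinct[OF inj(2)] that unfolding img by blast
  have "crossings_bounded ?F (?h ` ?g ` ?F)"
    by (rule crossings_bounded_trans[OF T d1 d2]) (simp_all add: e h(3) 1)
  moreover have "crossings_bounded (?h ` ?g ` ?F) ?F"
    by (rule crossings_bounded_trans[OF T d2 d1]) (simp_all add: e h(4) 2)
  moreover have "(h \<circ> g) ` Qhat = Qhat"
    using h(2) g(2) by (metis image_comp)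
  ultimately show ?thesis
    unfolding MH_iff img using hg by blast
qed

text \<open>Applying \<open>h\<inverse>\<close> to the pair \<open>F\<close>, \<open>h(F)\<close> gives the pair \<open>h\<inverse>(F)\<close>, \<open>F\<close>.\<close>

lemma inverse_in_MH:
  assumes "h \<in> MH"
  shows "inv_into UNIV h \<in> MH" "inv_into UNIV h \<circ> h = id"
proof -
  let ?F = farey_edges
  let ?k = "inv_into UNIV h"
  have h: "homeomorphic_map Rhat Rhat h" "h ` Qhat = Qhat"
    "crossings_bounded ?F (map_prod h h ` ?F)" "crossings_bounded (map_prod h h ` ?F) ?F"
    using assms by (simp_all add: MH_iff)
  have inj: "inj h"
    using homeomorphism_inverse(1)[OF h(1)] by (rule bij_is_inj)
  then show kh: "?k \<circ> h = id"
    by (rule inv_o_cancel)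
  have k: "homeomorphic_map Rhat Rhat ?k"
    by (rule homeomorphism_inverse(2)[OF h(1)])
  have img: "map_prod ?k ?k ` map_prod h h ` ?F = ?F"
    by (simp add: image_comp map_prod.comp kh map_prod.id)
  have "?k ` h ` Qhat = Qhat"
    by (simp only: image_comp kh image_id id_apply)
  then have "?k ` Qhat = Qhat"
    unfolding h(2) .
  moreover have "crossings_bounded (map_prod ?k ?k ` ?F) ?F"
    using crossings_bounded_image[OF k h(3)] unfolding img .
  moreover have "crossings_bounded ?F (map_prod ?k ?k ` ?F)"
    using crossings_bounded_image[OF k h(4)] unfolding img .
  ultimately show "?k \<in> MH"
    unfolding MH_iff using k by blast
qed

theorem theorem1p3: "group \<lparr>carrier = MH, mult = (\<circ>), one = id\<rparr>"
proof (rule groupI)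
  fix h assume "h \<in> carrier \<lparr>carrier = MH, mult = (\<circ>), one = id\<rparr>"
  then show "\<exists>k\<in>carrier \<lparr>carrier = MH, mult = (\<circ>), one = id\<rparr>.
      k \<otimes>\<^bsub>\<lparr>carrier = MH, mult = (\<circ>), one = id\<rparr>\<^esub> h = \<one>\<^bsub>\<lparr>carrier = MH, mult = (\<circ>), one = id\<rparr>\<^esub>"
    using inverse_in_MH by auto
qed (simp_all add: comp_in_MH id_in_MH comp_assoc)

end
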